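(* Let $Z(t)$ be the quasi-birth-and-death Markov chain, described in the context, that models the two-server system with arrival probability $\lambda$ under the output observation scheme and a given finite state controller $\big(N^{(1)},S^{(1)},F^{(1)},N^{(2)},S^{(2)},F^{(2)},C\big)$, with transition matrix $$A=\begin{pmatrix}\tilde A_0&\tilde A_1& & & \\ A_{-1}&A_0&A_1& & \\ &A_{-1}&A_0&A_1& \\ & &\ddots&\ddots&\ddots\end{pmatrix},$$ where $\tilde A_0=(1-\lambda)\tilde N$, $\tilde A_1=\lambda\tilde N$, $A_{-1}=(1-\lambda)\tilde S$, $A_0=(1-\lambda)\tilde F+\lambda\tilde S$, $A_1=\lambda\tilde F$. Let $\pi_\infty$ be the stationary distribution (row vector) of the finite stochastic matrix $A_{-1}+A_0+A_1$. Then $\pi_\infty$ is also the stationary distribution of $\tilde S+\tilde F$ and does not depend on $\lambda$, and a sufficient condition for $Z(t)$ to be positive recurrent is $$\lambda<\mu^*:=\pi_\infty\tilde S\,\mathbf 1,$$ where $\mathbf 1$ is the column vector of ones; here $\mu^*$ depends on the controller and system parameters but not on $\lambda$.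
   Context: Notation: $\bar x=1-x$; $\otimes$ is the Kronecker product; $C'$ is the transpose of $C$; $\mathrm{vec}(\cdot)$ stacks the columns of a matrix into a vector; $\mathrm{diag}(v)$ is the diagonal matrix with diagonal $v$; $\bar C$ is the matrix with entries $1-C_{i,j}$. **System parameters.** The arrival probability is $\lambda\in(0,1)$. For servers $j=1,2$ the environment $X_j(t)\in\{0,1\}$ is an independent two-state Markov chain with transition matrix $P^{(j)}=\begin{pmatrix}\bar p_j & p_j \\ q_j & \bar q_j\end{pmatrix}$, $p_j,q_j\in(0,1)$. Service by server $j$ when its environment is in state $i$ succeeds with probability $\mu_i^{(j)}$, where $\mu_0^{(2)}\le\mu_0^{(1)}<\mu_1^{(1)}\le\mu_1^{(2)}$. **Controller.** Fix an integer $M\ge1$. The controller state is $(\psi_1(t),\psi_2(t))\in\{1,\ldots,M\}^2$. The $M\times M$ matrix $C$ has entries in $[0,1]$. When the queue is nonempty, Server 2 is chosen with probability $C_{\psi_1(t),\psi_2(t)}$ and otherwise Server 1 is chosen. The $M\times M$ stochastic matrices $N^{(j)},S^{(j)},F^{(j)}$, $j=1,2$, have strictly positive entries. They give the transition probabilities of $\psi_j$ when server $j$ is not selected (including when the queue is empty), when it is selected and service succeeds, and when it is selected and service fails, respectively. **Chain.** $Z(t)=\big(Q(t),((X_1(t),X_2(t)),(\psi_1(t),\psi_2(t)))\big)\in\{0,1,\ldots\}\times\{0,1\}^2\times\{1,\ldots,M\}^2$, with states ordered lexicographically. The level is the queue length $Q(t)$ and the phase consists of the remaining components ($4M^2$ phases).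 For $k,\ell\in\{0,1\}$ define the $M^2\times M^2$ matrices $$\tilde S_{k\ell}=\mu_\ell^{(2)}\,\mathrm{diag}(\mathrm{vec}(C'))\,(N^{(1)}\otimes S^{(2)})+\mu_k^{(1)}\,\mathrm{diag}(\mathrm{vec}(\bar C'))\,(S^{(1)}\otimes N^{(2)}),$$ $$\tilde F_{k\ell}=\bar\mu_\ell^{(2)}\,\mathrm{diag}(\mathrm{vec}(C'))\,(N^{(1)}\otimes F^{(2)})+\bar\mu_k^{(1)}\,\mathrm{diag}(\mathrm{vec}(\bar C'))\,(F^{(1)}\otimes N^{(2)}),$$ $$\tilde N_{k\ell}=N^{(1)}\otimes N^{(2)}.$$ Let $\tilde S$ be the $4M^2\times4M^2$ matrix made of $M^2\times M^2$ blocks indexed by environment pairs $(k,\ell),(k',\ell')\in\{0,1\}^2$ (ordered $00,01,10,11$), whose block in position $\big((k,\ell),(k',\ell')\big)$ is $P^{(1)}_{k,k'}P^{(2)}_{\ell,\ell'}\,\tilde S_{k\ell}$. Define $\tilde F$ and $\tilde N$ in the same way from $\tilde F_{k\ell}$ and $\tilde N_{k\ell}$. Thus $\tilde S$, $\tilde F$, $\tilde N$ describe the change of phase together with a service success, a service failure, or no service attempt, respectively. *)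

theory Defs
  imports "HOL-Probability.Probability"
begin

section \<open>Matrices\<close>

text \<open>
  A matrix of type \<open>real ^ 'n ^ 'm\<close> has rows indexed by \<open>'m\<close> and columns by \<open>'n\<close>.  Positions in the
  lexicographic order of pairs are rendered by the product index type itself, so the block structure
  of a Kronecker product, of stacked columns and of the phase space is carried by the components of
  a pair.
\<close>

definition kronecker :: "real ^ 'b ^ 'a \<Rightarrow> real ^ 'd ^ 'c \<Rightarrow> real ^ ('b \<times> 'd) ^ ('a \<times> 'c)"
    (infixl \<open>\<otimes>\<^sub>K\<close> 72)
  where "A \<otimes>\<^sub>K B = (\<chi> r c. A $ fst r $ fst c * B $ snd r $ snd c)"

text \<open>Component \<open>(j, i)\<close> is row \<open>i\<close> of column \<open>j\<close>: the columns are stacked one after the other.\<close>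

definition vectorize :: "real ^ 'n ^ 'm \<Rightarrow> real ^ ('n \<times> 'm)"
  where "vectorize A = (\<chi> r. A $ snd r $ fst r)"

definition diag :: "real ^ 'n \<Rightarrow> real ^ 'n ^ 'n"
  where "diag v = (\<chi> i j. if i = j then v $ i else 0)"

definition complement_matrix :: "real ^ 'n ^ 'm \<Rightarrow> real ^ 'n ^ 'm"
  where "complement_matrix C = (\<chi> i j. 1 - C $ i $ j)"

definition stochastic_matrix :: "real ^ 'n ^ 'n \<Rightarrow> bool"
  where "stochastic_matrix A \<longleftrightarrow> (\<forall>i j. 0 \<le> A $ i $ j) \<and> (\<forall>i. (\<Sum>j\<in>UNIV. A $ i $ j) = 1)"

definition is_stationary_distribution :: "real ^ 'n \<Rightarrow> real ^ 'n ^ 'n \<Rightarrow> bool"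
  where "is_stationary_distribution \<pi> A \<longleftrightarrow>
    (\<forall>i. 0 \<le> \<pi> $ i) \<and> (\<Sum>i\<in>UNIV. \<pi> $ i) = 1 \<and> \<pi> v* A = \<pi>"


section \<open>Markov chains on a countable state space\<close>

text \<open>
  A transition matrix on \<open>'s\<close> is a function \<open>A :: 's \<Rightarrow> 's \<Rightarrow> real\<close>.  A chain is presented as a
  process \<open>Z\<close> together with the family of laws \<open>Pr z\<close> under which it starts in \<open>z\<close>.  The Markov
  property is stated multiplicatively, so that no conditioning on null events is involved.
\<close>

definition markov_chain ::
    "('s::countable \<Rightarrow> 's \<Rightarrow> real) \<Rightarrow> ('s \<Rightarrow> 'w measure) \<Rightarrow> (nat \<Rightarrow> 'w \<Rightarrow> 's) \<Rightarrow> bool"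
  where "markov_chain A Pr Z \<longleftrightarrow>
    (\<forall>z. prob_space (Pr z) \<and>
         (\<forall>t. Z t \<in> Pr z \<rightarrow>\<^sub>M count_space UNIV) \<and>
         (AE \<omega> in Pr z. Z 0 \<omega> = z) \<and>
         (\<forall>n (x :: nat \<Rightarrow> 's).
            measure (Pr z) {\<omega> \<in> space (Pr z). \<forall>t\<le>Suc n. Z t \<omega> = x t} =
            measure (Pr z) {\<omega> \<in> space (Pr z). \<forall>t\<le>n. Z t \<omega> = x t} * A (x n) (x (Suc n))))"

text \<open>The infimum is \<open>\<infinity>\<close> if the chain never returns.\<close>

definition return_time :: "(nat \<Rightarrow> 'w \<Rightarrow> 's) \<Rightarrow> 's \<Rightarrow> 'w \<Rightarrow> ennreal"
  where "return_time Z z \<omega> = (INF t\<in>{t. 1 \<le> t \<and> Z t \<omega> = z}. of_nat t)"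

definition positive_recurrent :: "('s \<Rightarrow> 'w measure) \<Rightarrow> (nat \<Rightarrow> 'w \<Rightarrow> 's) \<Rightarrow> bool"
  where "positive_recurrent Pr Z \<longleftrightarrow> (\<forall>z. (\<integral>\<^sup>+ \<omega>. return_time Z z \<omega> \<partial>Pr z) < \<infinity>)"

text \<open>Every transition matrix, given by its rows, is the transition matrix of some chain.\<close>

lemma markov_chain_exists:
  fixes K :: "'s::countable \<Rightarrow> 's pmf"
  shows "\<exists>(Pr :: 's \<Rightarrow> (nat \<Rightarrow> 's) measure) Z. markov_chain (\<lambda>x. pmf (K x)) Pr Z"
proof -
  define \<Omega> where "\<Omega> = PiM (UNIV :: (nat \<times> 's) set) (\<lambda>p. measure_pmf (K (snd p)))"
  interpret P: product_prob_space "\<lambda>p :: nat \<times> 's. measure_pmf (K (snd p))" UNIV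
    by standard
  have prob: "prob_space \<Omega>"
    unfolding \<Omega>_def by (rule prob_space_PiM) (rule prob_space_measure_pmf)
  interpret \<Omega>: prob_space \<Omega> by (rule prob)
  have space: "space \<Omega> = UNIV"
    by (simp add: \<Omega>_def space_PiM)
  \<comment> \<open>\<open>\<omega> (n, x)\<close> is the successor of \<open>x\<close> in step \<open>n\<close>.\<close>
  define Y where "Y z \<omega> t = rec_nat z (\<lambda>n x. \<omega> (n, x)) t" for z :: 's and \<omega> t
  have Y: "Y z \<omega> 0 = z" "Y z \<omega> (Suc n) = \<omega> (n, Y z \<omega> n)" for z \<omega> n
    by (simp_all add: Y_def)
  have coord: "(\<lambda>\<omega>. \<omega> p) \<in> \<Omega> \<rightarrow>\<^sub>M count_space UNIV" for p
  proof -
    have "(\<lambda>\<omega>. \<omega> p) \<in> \<Omega> \<rightarrow>\<^sub>M measure_pmf (K (snd p))"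
      unfolding \<Omega>_def by (rule measurable_component_singleton) simp
    then show ?thesis by simp
  qed
  have measY: "(\<lambda>\<omega>. Y z \<omega> n) \<in> \<Omega> \<rightarrow>\<^sub>M count_space UNIV" for z n
  proof (induction n)
    case 0
    then show ?case by (simp add: Y)
  next
    case (Suc n)
    have "(\<lambda>\<omega>. (\<lambda>x \<omega>. \<omega> (n, x)) (Y z \<omega> n) \<omega>) \<in> \<Omega> \<rightarrow>\<^sub>M count_space UNIV"
      by (rule measurable_compose_countable[OF coord Suc])
    then show ?case by (simp add: Y)
  qed
  have path: "(\<forall>t\<le>n. Y z \<omega> t = x t) \<longleftrightarrow> x 0 = z \<and> (\<forall>t<n. \<omega> (t, x t) = x (Suc t))" for z \<omega> n x
  proof (induction n)
    case 0
    then show ?case by (auto simp: Y)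
  next
    case (Suc n)
    have "(\<forall>t\<le>Suc n. Y z \<omega> t = x t) \<longleftrightarrow> (\<forall>t\<le>n. Y z \<omega> t = x t) \<and> Y z \<omega> (Suc n) = x (Suc n)"
      by (auto simp: le_Suc_eq)
    also have "\<dots> \<longleftrightarrow> (\<forall>t\<le>n. Y z \<omega> t = x t) \<and> \<omega> (n, x n) = x (Suc n)"
      by (auto simp: Y)
    also have "\<dots> \<longleftrightarrow> x 0 = z \<and> (\<forall>t<Suc n. \<omega> (t, x t) = x (Suc t))"
      unfolding Suc.IH by (auto simp: less_Suc_eq)
    finally show ?case .
  qed
  have emeas: "measure \<Omega> {\<omega> \<in> space \<Omega>. \<forall>t\<le>n. Y z \<omega> t = x t} =
      (if x 0 = z then \<Prod>t<n. pmf (K (x t)) (x (Suc t)) else 0)" for z n x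
  proof (cases "x 0 = z")
    case True
    define J where "J = (\<lambda>t. (t, x t)) ` {..<n}"
    have "{\<omega> \<in> space \<Omega>. \<forall>t\<le>n. Y z \<omega> t = x t} =
        {\<omega> \<in> space \<Omega>. \<forall>p\<in>J. \<omega> p \<in> {x (Suc (fst p))}}"
      using True by (auto simp: path J_def)
    also have "emeasure \<Omega> \<dots> = (\<Prod>p\<in>J. emeasure (measure_pmf (K (snd p))) {x (Suc (fst p))})"
      unfolding \<Omega>_def by (rule P.emeasure_PiM_Collect) (auto simp: J_def)
    also have "\<dots> = (\<Prod>t<n. ennreal (pmf (K (x t)) (x (Suc t))))"
      unfolding J_def by (subst prod.reindex) (auto simp: inj_on_def emeasure_pmf_single)
    also have "\<dots> = ennreal (\<Prod>t<n. pmf (K (x t)) (x (Suc t)))"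
      by (simp add: prod_ennreal)
    finally show ?thesis
      using True by (simp add: measure_def prod_nonneg)
  qed (auto simp: path)
  define Pr where "Pr z = distr \<Omega> (PiM UNIV (\<lambda>_. count_space UNIV)) (Y z)" for z
  define Z where "Z t \<omega> = \<omega> t" for t :: nat and \<omega> :: "nat \<Rightarrow> 's"
  have T: "Y z \<in> \<Omega> \<rightarrow>\<^sub>M PiM UNIV (\<lambda>_. count_space UNIV)" for z
    by (rule measurable_PiM_single') (auto intro: measY)
  have Z: "Z t \<in> PiM UNIV (\<lambda>_. count_space UNIV) \<rightarrow>\<^sub>M count_space UNIV" for t
    unfolding Z_def[abs_def] by (rule measurable_component_singleton) simp
  have Zm [measurable]: "Z t \<in> Pr z \<rightarrow>\<^sub>M count_space UNIV" for t z
    unfolding Pr_def using Z by simp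
  have "measure (Pr z) {\<omega> \<in> space (Pr z). \<forall>t\<le>n. Z t \<omega> = x t} =
      measure \<Omega> {\<omega> \<in> space \<Omega>. \<forall>t\<le>n. Y z \<omega> t = x t}" for z n x
  proof -
    have "{\<omega> \<in> space (Pr z). \<forall>t\<le>n. Z t \<omega> = x t} \<in> sets (Pr z)"
      by measurable
    then show ?thesis
      unfolding Pr_def
      by (subst measure_distr[OF T])
        (auto simp: Z_def space_PiM space intro!: arg_cong[where f = "measure \<Omega>"])
  qed
  moreover have "AE \<omega> in Pr z. Z 0 \<omega> = z" for z
  proof -
    have "{\<omega> \<in> space (PiM UNIV (\<lambda>_. count_space UNIV)). Z 0 \<omega> = z} \<in> sets (PiM UNIV (\<lambda>_. count_space UNIV))"
      using Z by measurable
    then show ?thesis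
      unfolding Pr_def by (subst AE_distr_iff[OF T]) (auto simp: Z_def Y)
  qed
  moreover have "prob_space (Pr z)" for z
    unfolding Pr_def by (rule \<Omega>.prob_space_distr[OF T])
  ultimately have "markov_chain (\<lambda>x. pmf (K x)) Pr Z"
    unfolding markov_chain_def using Zm by (auto simp: emeas)
  then show ?thesis by blast
qed


section \<open>The two-server system\<close>

text \<open>
  Environment states and service outcomes are Booleans, \<open>False\<close> standing for 0 and \<open>True\<close> for 1.
  The first argument of a field is the server; only its values at 1 and 2 matter.
\<close>

record system =
  env_p :: "nat \<Rightarrow> real"
  env_q :: "nat \<Rightarrow> real"
  service_prob :: "nat \<Rightarrow> bool \<Rightarrow> real"

text \<open>The \<open>M\<close> states of each controller component are the elements of \<open>'m\<close>.\<close>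

record ('m) controller =
  ctl_N :: "nat \<Rightarrow> real ^ 'm ^ 'm"
  ctl_S :: "nat \<Rightarrow> real ^ 'm ^ 'm"
  ctl_F :: "nat \<Rightarrow> real ^ 'm ^ 'm"
  ctl_C :: "real ^ 'm ^ 'm"

definition valid_system :: "system \<Rightarrow> bool"
  where "valid_system sys \<longleftrightarrow>
    (\<forall>j\<in>{1, 2}. 0 < env_p sys j \<and> env_p sys j < 1 \<and> 0 < env_q sys j \<and> env_q sys j < 1) \<and>
    (\<forall>j\<in>{1, 2}. \<forall>i. 0 \<le> service_prob sys j i \<and> service_prob sys j i \<le> 1) \<and>
    service_prob sys 2 False \<le> service_prob sys 1 False \<and>
    service_prob sys 1 False < service_prob sys 1 True \<and>
    service_prob sys 1 True \<le> service_prob sys 2 True"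

definition valid_controller :: "('m::finite) controller \<Rightarrow> bool"
  where "valid_controller ctl \<longleftrightarrow>
    (\<forall>j\<in>{1, 2}. \<forall>R\<in>{ctl_N ctl j, ctl_S ctl j, ctl_F ctl j}.
       stochastic_matrix R \<and> (\<forall>a b. 0 < R $ a $ b)) \<and>
    (\<forall>a b. 0 \<le> ctl_C ctl $ a $ b \<and> ctl_C ctl $ a $ b \<le> 1)"

definition env_matrix :: "system \<Rightarrow> nat \<Rightarrow> real ^ bool ^ bool"
  where "env_matrix sys j = (\<chi> k k'.
    if \<not> k then (if \<not> k' then 1 - env_p sys j else env_p sys j)
    else (if \<not> k' then env_q sys j else 1 - env_q sys j))"

type_synonym 'm phase = "(bool \<times> bool) \<times> ('m \<times> 'm)"

type_synonym 'm phase_matrix = "real ^ 'm phase ^ 'm phase"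

definition success_block ::
    "system \<Rightarrow> 'm controller \<Rightarrow> bool \<Rightarrow> bool \<Rightarrow> real ^ ('m::finite \<times> 'm) ^ ('m \<times> 'm)"
  where "success_block sys ctl k l =
    service_prob sys 2 l *\<^sub>R
      (diag (vectorize (transpose (ctl_C ctl))) ** (ctl_N ctl 1 \<otimes>\<^sub>K ctl_S ctl 2)) +
    service_prob sys 1 k *\<^sub>R
      (diag (vectorize (transpose (complement_matrix (ctl_C ctl)))) ** (ctl_S ctl 1 \<otimes>\<^sub>K ctl_N ctl 2))"

definition failure_block ::
    "system \<Rightarrow> 'm controller \<Rightarrow> bool \<Rightarrow> bool \<Rightarrow> real ^ ('m::finite \<times> 'm) ^ ('m \<times> 'm)"
  where "failure_block sys ctl k l =
    (1 - service_prob sys 2 l) *\<^sub>R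
      (diag (vectorize (transpose (ctl_C ctl))) ** (ctl_N ctl 1 \<otimes>\<^sub>K ctl_F ctl 2)) +
    (1 - service_prob sys 1 k) *\<^sub>R
      (diag (vectorize (transpose (complement_matrix (ctl_C ctl)))) ** (ctl_F ctl 1 \<otimes>\<^sub>K ctl_N ctl 2))"

definition idle_block ::
    "system \<Rightarrow> 'm controller \<Rightarrow> bool \<Rightarrow> bool \<Rightarrow> real ^ ('m::finite \<times> 'm) ^ ('m \<times> 'm)"
  where "idle_block sys ctl k l = ctl_N ctl 1 \<otimes>\<^sub>K ctl_N ctl 2"

definition assemble ::
    "system \<Rightarrow> (bool \<Rightarrow> bool \<Rightarrow> real ^ ('m \<times> 'm) ^ ('m \<times> 'm)) \<Rightarrow> ('m::finite) phase_matrix"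
  where "assemble sys B = (\<chi> r c. case (r, c) of (((k, l), a), ((k', l'), b)) \<Rightarrow>
    env_matrix sys 1 $ k $ k' * env_matrix sys 2 $ l $ l' * B k l $ a $ b)"

definition S_tilde :: "system \<Rightarrow> 'm controller \<Rightarrow> ('m::finite) phase_matrix"
  where "S_tilde sys ctl = assemble sys (success_block sys ctl)"

definition F_tilde :: "system \<Rightarrow> 'm controller \<Rightarrow> ('m::finite) phase_matrix"
  where "F_tilde sys ctl = assemble sys (failure_block sys ctl)"

definition N_tilde :: "system \<Rightarrow> 'm controller \<Rightarrow> ('m::finite) phase_matrix"
  where "N_tilde sys ctl = assemble sys (idle_block sys ctl)"


section \<open>The quasi-birth-and-death chain\<close>

text \<open>Arguments: the two boundary blocks of level 0, then the blocks for steps -1, 0 and 1.\<close>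

definition qbd_matrix ::
    "real ^ 'p ^ 'p \<Rightarrow> real ^ 'p ^ 'p \<Rightarrow> real ^ 'p ^ 'p \<Rightarrow> real ^ 'p ^ 'p \<Rightarrow> real ^ 'p ^ 'p \<Rightarrow>
     nat \<times> 'p \<Rightarrow> nat \<times> 'p \<Rightarrow> real"
  where "qbd_matrix B0 B1 Am1 A0 A1 = (\<lambda>(n, i) (m, j).
    if n = 0 then (if m = 0 then B0 $ i $ j else if m = 1 then B1 $ i $ j else 0)
    else if Suc m = n then Am1 $ i $ j
    else if m = n then A0 $ i $ j
    else if m = Suc n then A1 $ i $ j
    else 0)"

definition A_down :: "real \<Rightarrow> system \<Rightarrow> 'm controller \<Rightarrow> ('m::finite) phase_matrix"
  where "A_down lam sys ctl = (1 - lam) *\<^sub>R S_tilde sys ctl"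

definition A_same :: "real \<Rightarrow> system \<Rightarrow> 'm controller \<Rightarrow> ('m::finite) phase_matrix"
  where "A_same lam sys ctl = (1 - lam) *\<^sub>R F_tilde sys ctl + lam *\<^sub>R S_tilde sys ctl"

definition A_up :: "real \<Rightarrow> system \<Rightarrow> 'm controller \<Rightarrow> ('m::finite) phase_matrix"
  where "A_up lam sys ctl = lam *\<^sub>R F_tilde sys ctl"

definition queue_matrix ::
    "real \<Rightarrow> system \<Rightarrow> ('m::finite) controller \<Rightarrow> nat \<times> 'm phase \<Rightarrow> nat \<times> 'm phase \<Rightarrow> real"
  where "queue_matrix lam sys ctl =
    qbd_matrix ((1 - lam) *\<^sub>R N_tilde sys ctl) (lam *\<^sub>R N_tilde sys ctl)
      (A_down lam sys ctl) (A_same lam sys ctl) (A_up lam sys ctl)"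

definition phase_process_matrix :: "real \<Rightarrow> system \<Rightarrow> 'm controller \<Rightarrow> ('m::finite) phase_matrix"
  where "phase_process_matrix lam sys ctl =
    A_down lam sys ctl + A_same lam sys ctl + A_up lam sys ctl"

text \<open>Meaningful when the stationary distribution exists and is unique.\<close>

definition pi_inf :: "real \<Rightarrow> system \<Rightarrow> ('m::finite) controller \<Rightarrow> real ^ 'm phase"
  where "pi_inf lam sys ctl =
    (THE \<pi>. is_stationary_distribution \<pi> (phase_process_matrix lam sys ctl))"

definition mu_star :: "real \<Rightarrow> system \<Rightarrow> ('m::finite) controller \<Rightarrow> real"
  where "mu_star lam sys ctl = (pi_inf lam sys ctl v* S_tilde sys ctl) \<bullet> (\<chi> i. 1)"


section \<open>The dynamics of the system\<close>

text \<open>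
  One time slot of the system.  Theorem \<open>pmf_slot\<close> confirms that its transition probabilities are the
  entries of the block matrix.
\<close>

definition row_pmf :: "real ^ 'n ^ 'n \<Rightarrow> 'n \<Rightarrow> ('n::finite) pmf"
  where "row_pmf R a = embed_pmf (\<lambda>b. R $ a $ b)"

definition slot ::
    "real \<Rightarrow> system \<Rightarrow> ('m::finite) controller \<Rightarrow> nat \<times> 'm phase \<Rightarrow> (nat \<times> 'm phase) pmf"
  where "slot lam sys ctl = (\<lambda>(n, (k, l), (a, b)).
    do {
      arrival \<leftarrow> bernoulli_pmf lam;
      k' \<leftarrow> row_pmf (env_matrix sys 1) k;
      l' \<leftarrow> row_pmf (env_matrix sys 2) l;
      if n = 0 then do {
        a' \<leftarrow> row_pmf (ctl_N ctl 1) a;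
        b' \<leftarrow> row_pmf (ctl_N ctl 2) b;
        return_pmf (of_bool arrival, (k', l'), (a', b'))
      } else do {
        second \<leftarrow> bernoulli_pmf (ctl_C ctl $ a $ b);
        success \<leftarrow> bernoulli_pmf (if second then service_prob sys 2 l else service_prob sys 1 k);
        a' \<leftarrow> row_pmf (if second then ctl_N ctl 1 else if success then ctl_S ctl 1 else ctl_F ctl 1) a;
        b' \<leftarrow> row_pmf (if \<not> second then ctl_N ctl 2 else if success then ctl_S ctl 2 else ctl_F ctl 2) b;
        return_pmf (n - of_bool success + of_bool arrival, (k', l'), (a', b'))
      }
    })"

lemma pmf_row_pmf:
  assumes "stochastic_matrix R"
  shows "pmf (row_pmf R a) b = R $ a $ b"
proof -
  have *: "(\<integral>\<^sup>+ b. ennreal (R $ a $ b) \<partial>count_space UNIV) = 1"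
    using assms by (simp add: nn_integral_count_space_finite stochastic_matrix_def sum_ennreal)
  show ?thesis
    unfolding row_pmf_def using assms * by (subst pmf_embed_pmf) (auto simp: stochastic_matrix_def)
qed

lemma stochastic_env_matrix:
  assumes "valid_system sys" and "j \<in> {1, 2}"
  shows "stochastic_matrix (env_matrix sys j)"
  using assms by (auto simp: stochastic_matrix_def env_matrix_def valid_system_def UNIV_bool less_imp_le)

lemma pmf_bind_bernoulli:
  assumes "0 \<le> p" "p \<le> 1"
  shows "pmf (bernoulli_pmf p \<bind> f) x = p * pmf (f True) x + (1 - p) * pmf (f False) x"
  using assms by (simp add: pmf_bind)

lemma pmf_bind_finite:
  fixes M :: "('a::finite) pmf"
  shows "pmf (M \<bind> f) x = (\<Sum>y\<in>UNIV. pmf M y * pmf (f y) x)"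
  by (simp add: pmf_bind integral_measure_pmf_real[where A = UNIV] mult.commute)

lemma pmf_bind_pair:
  fixes M :: "('a::finite) pmf" and L :: "('b::finite) pmf"
  shows "pmf (M \<bind> (\<lambda>a. L \<bind> (\<lambda>b. return_pmf (n, e, (a, b))))) (m, e', (a', b')) =
    (if n = m \<and> e = e' then pmf M a' * pmf L b' else 0)"
proof (cases "n = m \<and> e = e'")
  case True
  have ret: "pmf (return_pmf (n, e, (a, b))) (m, e', (a', b')) = (if a = a' then 1 else 0) * (if b = b' then 1 else 0)"
    for a b
    using True by (auto simp: indicator_def)
  have "pmf (M \<bind> (\<lambda>a. L \<bind> (\<lambda>b. return_pmf (n, e, (a, b))))) (m, e', (a', b')) =
      (\<Sum>a\<in>UNIV. pmf M a * (if a = a' then 1 else 0)) * (\<Sum>b\<in>UNIV. pmf L b * (if b = b' then 1 else 0))"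
    unfolding pmf_bind_finite ret sum_product
    by (simp only: sum_distrib_left mult.assoc mult.left_commute)
  then show ?thesis
    using True by (simp add: if_distrib[of "(*) _"] cong: if_cong)
qed (auto simp: pmf_bind_finite indicator_def)

lemma pmf_bind_env:
  fixes M :: "('a::finite) pmf" and L :: "('b::finite) pmf"
  assumes "\<And>k l. pmf (G k l) x = (if k = k' \<and> l = l' then g else 0)"
  shows "pmf (M \<bind> (\<lambda>k. L \<bind> G k)) x = pmf M k' * pmf L l' * g"
proof -
  have G: "pmf (G k l) x = (if k = k' then 1 else 0) * ((if l = l' then 1 else 0) * g)" for k l
    by (simp add: assms)
  have "pmf (M \<bind> (\<lambda>k. L \<bind> G k)) x =
      (\<Sum>k\<in>UNIV. pmf M k * (if k = k' then 1 else 0)) *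
      (\<Sum>l\<in>UNIV. pmf L l * (if l = l' then 1 else 0)) * g"
    unfolding pmf_bind_finite G sum_product sum_distrib_right
    by (simp only: sum_distrib_left sum_distrib_right mult.assoc mult.left_commute)
  then show ?thesis
    by (simp add: if_distrib[of "(*) _"] cong: if_cong)
qed

lemma diag_mult: "(diag v ** B) $ r $ c = v $ r * B $ r $ c"
  by (simp add: matrix_matrix_mult_def diag_def if_distrib[of "\<lambda>x. x * _"] cong: if_cong)

lemma diag_vectorize_mult:
  "(diag (vectorize (transpose C)) ** B) $ (a, b) $ c = C $ a $ b * B $ (a, b) $ c"
  by (simp add: diag_mult vectorize_def transpose_def)

theorem pmf_slot:
  fixes ctl :: "('m::finite) controller"
  assumes "0 < lam" "lam < 1" and sys: "valid_system sys" and ctl: "valid_controller ctl"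
  shows "pmf (slot lam sys ctl z) z' = queue_matrix lam sys ctl z z'"
proof -
  obtain n k l a b where z: "z = (n, (k, l), (a, b))" by (metis prod.exhaust)
  obtain m k' l' a' b' where z': "z' = (m, (k', l'), (a', b'))" by (metis prod.exhaust)
  have env: "pmf (row_pmf (env_matrix sys 1) k) k' = env_matrix sys 1 $ k $ k'"
    "pmf (row_pmf (env_matrix sys 2) l) l' = env_matrix sys 2 $ l $ l'"
    using sys by (simp_all add: pmf_row_pmf stochastic_env_matrix)
  have rows: "pmf (row_pmf (ctl_N ctl 1) a) a' = ctl_N ctl 1 $ a $ a'"
    "pmf (row_pmf (ctl_S ctl 1) a) a' = ctl_S ctl 1 $ a $ a'"
    "pmf (row_pmf (ctl_F ctl 1) a) a' = ctl_F ctl 1 $ a $ a'"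
    "pmf (row_pmf (ctl_N ctl 2) b) b' = ctl_N ctl 2 $ b $ b'"
    "pmf (row_pmf (ctl_S ctl 2) b) b' = ctl_S ctl 2 $ b $ b'"
    "pmf (row_pmf (ctl_F ctl 2) b) b' = ctl_F ctl 2 $ b $ b'"
    using ctl by (simp_all add: valid_controller_def pmf_row_pmf)
  have C: "0 \<le> ctl_C ctl $ a $ b" "ctl_C ctl $ a $ b \<le> 1"
    using ctl by (auto simp: valid_controller_def)
  have mu: "0 \<le> service_prob sys 1 k" "service_prob sys 1 k \<le> 1"
    "0 \<le> service_prob sys 2 l" "service_prob sys 2 l \<le> 1"
    using sys by (auto simp: valid_system_def)
  note defs = z z' queue_matrix_def qbd_matrix_def A_down_def A_same_def A_up_def
    S_tilde_def F_tilde_def N_tilde_def assemble_def success_block_def failure_block_def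
    idle_block_def diag_vectorize_mult kronecker_def complement_matrix_def
  show ?thesis
  proof (cases "n = 0")
    case True
    define g where "g arr = (if m = of_bool arr then ctl_N ctl 1 $ a $ a' * ctl_N ctl 2 $ b $ b' else 0)"
      for arr :: bool
    define inner where "inner arr k' l' = (row_pmf (ctl_N ctl 1) a \<bind> (\<lambda>a'.
      row_pmf (ctl_N ctl 2) b \<bind> (\<lambda>b'. return_pmf (of_bool arr :: nat, (k', l'), (a', b')))))"
      for arr and k' l' :: bool
    have "pmf (inner arr k'' l'') z' = (if k'' = k' \<and> l'' = l' then g arr else 0)" for arr k'' l''
      unfolding inner_def z' using C mu
      by (auto simp: pmf_bind_bernoulli pmf_bind_pair rows g_def simp del: One_nat_def)
    then have *: "pmf (row_pmf (env_matrix sys 1) k \<bind> (\<lambda>k'. row_pmf (env_matrix sys 2) l \<bind> inner arr k')) z' =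
        env_matrix sys 1 $ k $ k' * env_matrix sys 2 $ l $ l' * g arr" for arr
      by (subst pmf_bind_env[where g = "g arr"]) (auto simp only: env)
    have "slot lam sys ctl z = bernoulli_pmf lam \<bind> (\<lambda>arr. row_pmf (env_matrix sys 1) k \<bind>
        (\<lambda>k'. row_pmf (env_matrix sys 2) l \<bind> inner arr k'))"
      unfolding z slot_def inner_def[abs_def] using True by simp
    then have "pmf (slot lam sys ctl z) z' =
        lam * (env_matrix sys 1 $ k $ k' * env_matrix sys 2 $ l $ l' * g True) +
        (1 - lam) * (env_matrix sys 1 $ k $ k' * env_matrix sys 2 $ l $ l' * g False)"
      using assms(1,2) by (simp only: pmf_bind_bernoulli * less_imp_le)
    then show ?thesis
      using True by (auto simp: defs g_def)
  next
    case False
    define e where "e arr suc \<longleftrightarrow> n - of_bool suc + of_bool arr = m" for arr suc :: bool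
    define g where "g arr =
      ctl_C ctl $ a $ b *
        (service_prob sys 2 l * (if e arr True then ctl_N ctl 1 $ a $ a' * ctl_S ctl 2 $ b $ b' else 0) +
         (1 - service_prob sys 2 l) * (if e arr False then ctl_N ctl 1 $ a $ a' * ctl_F ctl 2 $ b $ b' else 0)) +
      (1 - ctl_C ctl $ a $ b) *
        (service_prob sys 1 k * (if e arr True then ctl_S ctl 1 $ a $ a' * ctl_N ctl 2 $ b $ b' else 0) +
         (1 - service_prob sys 1 k) * (if e arr False then ctl_F ctl 1 $ a $ a' * ctl_N ctl 2 $ b $ b' else 0))"
      for arr :: bool
    define inner where "inner arr k' l' = (
      bernoulli_pmf (ctl_C ctl $ a $ b) \<bind> (\<lambda>second.
      bernoulli_pmf (if second then service_prob sys 2 l else service_prob sys 1 k) \<bind> (\<lambda>success.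
      row_pmf (if second then ctl_N ctl 1 else if success then ctl_S ctl 1 else ctl_F ctl 1) a \<bind> (\<lambda>a'.
      row_pmf (if \<not> second then ctl_N ctl 2 else if success then ctl_S ctl 2 else ctl_F ctl 2) b \<bind> (\<lambda>b'.
      return_pmf (n - of_bool success + of_bool arr, (k', l'), (a', b')))))))"
      for arr and k' l' :: bool
    have "pmf (inner arr k'' l'') z' = (if k'' = k' \<and> l'' = l' then g arr else 0)" for arr k'' l''
      unfolding inner_def z' using C mu
      by (auto simp: pmf_bind_bernoulli pmf_bind_pair rows g_def e_def simp del: One_nat_def)
    then have *: "pmf (row_pmf (env_matrix sys 1) k \<bind> (\<lambda>k'. row_pmf (env_matrix sys 2) l \<bind> inner arr k')) z' =
        env_matrix sys 1 $ k $ k' * env_matrix sys 2 $ l $ l' * g arr" for arr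
      by (subst pmf_bind_env[where g = "g arr"]) (auto simp only: env)
    have "slot lam sys ctl z = bernoulli_pmf lam \<bind> (\<lambda>arr. row_pmf (env_matrix sys 1) k \<bind>
        (\<lambda>k'. row_pmf (env_matrix sys 2) l \<bind> inner arr k'))"
      unfolding z slot_def inner_def[abs_def] using False by simp
    then have "pmf (slot lam sys ctl z) z' =
        lam * (env_matrix sys 1 $ k $ k' * env_matrix sys 2 $ l $ l' * g True) +
        (1 - lam) * (env_matrix sys 1 $ k $ k' * env_matrix sys 2 $ l $ l' * g False)"
      using assms(1,2) by (simp only: pmf_bind_bernoulli * less_imp_le)
    moreover have "e True True \<longleftrightarrow> m = n" "e False False \<longleftrightarrow> m = n"
      "e True False \<longleftrightarrow> m = Suc n" "e False True \<longleftrightarrow> Suc m = n"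
      using False by (auto simp: e_def)
    ultimately show ?thesis
      using False by (auto simp: defs g_def algebra_simps)
  qed
qed

corollary queue_chain_exists:
  fixes ctl :: "('m::finite) controller"
  assumes "0 < lam" "lam < 1" "valid_system sys" "valid_controller ctl"
  shows "\<exists>(Pr :: _ \<Rightarrow> (nat \<Rightarrow> nat \<times> 'm phase) measure) Z.
    markov_chain (queue_matrix lam sys ctl) Pr Z"
proof -
  have "(\<lambda>z. pmf (slot lam sys ctl z)) = queue_matrix lam sys ctl"
    using pmf_slot[OF assms] by (intro ext) simp
  then show ?thesis
    using markov_chain_exists[of "slot lam sys ctl"] by simp
qed

end

theory Submission
  imports Defs
begin

text \<open>
  Summing the blocks cancels \<open>\<lambda>\<close>: \<open>A\<^sub>-\<^sub>1 + A\<^sub>0 + A\<^sub>1 = S + F =: P\<close>.  This matrix is stochastic and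
  entrywise positive, since in every phase a served customer either succeeds or fails, and both
  outcomes lead to every phase with positive controller and environment probabilities.  A positive
  stochastic matrix has exactly one stationary distribution, which therefore depends on \<open>\<lambda>\<close> no more
  than \<open>P\<close> does.
  
  For positive recurrence, a busy level has mean queue increment \<open>d\<^sub>i = \<lambda> - (S 1)\<^sub>i\<close> in phase \<open>i\<close>.
  Its sign may vary with the phase, but its average \<open>\<pi> d = \<lambda> - \<mu>\<^sup>*\<close> is negative.  A solution \<open>h\<close> of the
  Poisson equation \<open>h - P h = d - \<pi> d\<close> (\<open>poisson_equation\<close>) corrects the queue length, so that
  \<open>V (n, i) = n + h\<^sub>i\<close> has the same negative drift \<open>\<lambda> - \<mu>\<^sup>*\<close> in every phase of every busy level
  (\<open>qbd_positive_recurrent\<close>).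
  
  The chain then returns quickly to the finite level 0, but the claim concerns the return to one given
  state \<open>z\<close>.  Instead of a renewal argument over successive visits to level 0, the function \<open>V\<close> is
  changed once more (\<open>positive_recurrence_from_finite_set\<close>): with \<open>g\<^sub>k x\<close> the probability of hitting \<open>z\<close>
  from \<open>x\<close> within \<open>k\<close> steps, the bounded function \<open>\<Sum>k<m. 1 - g\<^sub>k\<close> has drift exactly \<open>- g\<^sub>m\<close> off \<open>z\<close> by
  telescoping.  Once \<open>m\<close> is so large that \<open>g\<^sub>m\<close> is positive on level 0, a multiple of it outweighs the
  upward drift of \<open>V\<close> there.  The sum has drift at most \<open>-1\<close> everywhere except at \<open>z\<close>, and Foster's
  criterion (\<open>foster_criterion\<close>) bounds the mean return time to \<open>z\<close>.
  
  The hitting probabilities are positive because the queue can grow from 0 to any length: in the phases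
  where both environments are in state 0 the strict inequality \<open>\<mu>\<^sub>0 < \<mu>\<^sub>1\<close> for the first server leaves
  room for a failure of either server (\<open>F_tilde_pos\<close>).
\<close>

section \<open>Foster's criterion for one state\<close>

text \<open>
  The Markov property, stated for single trajectories, passes to expectations restricted by any event
  of the past, because the finite histories are countably many and split that event into cylinders.
\<close>

lemma markov_chain_step:
  fixes A :: "'s::countable \<Rightarrow> 's \<Rightarrow> real" and f :: "'s \<Rightarrow> ennreal"
  assumes mc: "markov_chain A Pr Z" and nonneg: "\<And>x y. 0 \<le> A x y"
  shows "(\<integral>\<^sup>+\<omega>. f (Z (Suc t) \<omega>) * indicator {\<omega>. \<forall>s\<le>t. Q s (Z s \<omega>)} \<omega> \<partial>Pr z) =
    (\<integral>\<^sup>+\<omega>. (\<integral>\<^sup>+y. ennreal (A (Z t \<omega>) y) * f y \<partial>count_space UNIV) *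
      indicator {\<omega>. \<forall>s\<le>t. Q s (Z s \<omega>)} \<omega> \<partial>Pr z)"
    (is "(\<integral>\<^sup>+\<omega>. _ * indicator ?E \<omega> \<partial>_) = (\<integral>\<^sup>+\<omega>. ?g (Z t \<omega>) * _ \<partial>_)")
proof -
  interpret prob_space "Pr z" using mc by (simp add: markov_chain_def)
  have Z [measurable]: "Z t \<in> Pr z \<rightarrow>\<^sub>M count_space UNIV" for t
    using mc by (simp add: markov_chain_def)
  have cylinder: "measure (Pr z) {\<omega> \<in> space (Pr z). \<forall>s\<le>Suc t. Z s \<omega> = x s} =
      measure (Pr z) {\<omega> \<in> space (Pr z). \<forall>s\<le>t. Z s \<omega> = x s} * A (x t) (x (Suc t))" for x
    using mc by (simp add: markov_chain_def)
  define paths where "paths = {p \<in> {..t} \<rightarrow>\<^sub>E (UNIV :: 's set). \<forall>s\<le>t. Q s (p s)}"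
  define cyl where "cyl p = {\<omega> \<in> space (Pr z). \<forall>s\<le>t. Z s \<omega> = p s}" for p
  have cyl [measurable]: "cyl p \<in> sets (Pr z)" for p
    unfolding cyl_def by measurable
  have countable: "countable paths"
    unfolding paths_def by (rule countable_subset[OF _ countable_PiE[of "{..t}" "\<lambda>_. UNIV"]]) auto
  have split: "F * indicator ?E \<omega> = (\<integral>\<^sup>+p. F * indicator (cyl p) \<omega> \<partial>count_space paths)"
    if "\<omega> \<in> space (Pr z)" for F :: ennreal and \<omega>
  proof (cases "\<omega> \<in> ?E")
    case True
    define p where "p = restrict (\<lambda>s. Z s \<omega>) {..t}"
    have "p \<in> paths" using True by (auto simp: p_def paths_def)
    moreover have "\<omega> \<in> cyl p'  \<longleftrightarrow> p' = p" if "p' \<in> paths" for p'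
      using that \<open>\<omega> \<in> space (Pr z)\<close>
      by (auto simp: cyl_def p_def paths_def PiE_def extensional_def fun_eq_iff restrict_def)
    ultimately have "(\<integral>\<^sup>+p. F * indicator (cyl p) \<omega> \<partial>count_space paths) = (\<Sum>p'\<in>{p}. F * indicator (cyl p') \<omega>)"
      by (intro nn_integral_count_space') auto
    then show ?thesis
      using True \<open>p \<in> paths\<close> \<open>\<And>p'. p' \<in> paths \<Longrightarrow> \<omega> \<in> cyl p' \<longleftrightarrow> p' = p\<close> by simp
  next
    case False
    then have "\<omega> \<notin> cyl p" if "p \<in> paths" for p
      using that by (auto simp: cyl_def paths_def)
    then have "(\<integral>\<^sup>+p. F * indicator (cyl p) \<omega> \<partial>count_space paths) = (\<integral>\<^sup>+p. 0 \<partial>count_space paths)"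
      by (intro nn_integral_cong) auto
    with False show ?thesis by simp
  qed
  have next_value: "(\<integral>\<^sup>+\<omega>. f (Z (Suc t) \<omega>) * indicator (cyl p) \<omega> \<partial>Pr z) = emeasure (Pr z) (cyl p) * ?g (p t)"
    for p
  proof -
    have joint: "emeasure (Pr z) {\<omega> \<in> cyl p. Z (Suc t) \<omega> = y} = emeasure (Pr z) (cyl p) * ennreal (A (p t) y)"
      for y
    proof -
      have "{\<omega> \<in> cyl p. Z (Suc t) \<omega> = y} = {\<omega> \<in> space (Pr z). \<forall>s\<le>Suc t. Z s \<omega> = (p(Suc t := y)) s}"
        by (auto simp: cyl_def le_Suc_eq)
      moreover have "cyl p = {\<omega> \<in> space (Pr z). \<forall>s\<le>t. Z s \<omega> = (p(Suc t := y)) s}"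
        by (auto simp: cyl_def)
      ultimately show ?thesis
        using cylinder[of "p(Suc t := y)"] nonneg by (simp add: emeasure_eq_measure ennreal_mult)
    qed
    have pt: "f (Z (Suc t) \<omega>) * indicator (cyl p) \<omega> =
        (\<integral>\<^sup>+y. f y * indicator {\<omega> \<in> cyl p. Z (Suc t) \<omega> = y} \<omega> \<partial>count_space UNIV)" for \<omega>
      by (subst nn_integral_count_space'[where A = "{Z (Suc t) \<omega>}"]) (auto simp: indicator_def)
    have "(\<integral>\<^sup>+\<omega>. f (Z (Suc t) \<omega>) * indicator (cyl p) \<omega> \<partial>Pr z) =
        (\<integral>\<^sup>+y. \<integral>\<^sup>+\<omega>. f y * indicator {\<omega> \<in> cyl p. Z (Suc t) \<omega> = y} \<omega> \<partial>Pr z \<partial>count_space UNIV)"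
      unfolding pt by (rule nn_integral_count_space_nn_integral) auto
    also have "\<dots> = (\<integral>\<^sup>+y. emeasure (Pr z) (cyl p) * (ennreal (A (p t) y) * f y) \<partial>count_space UNIV)"
      by (subst nn_integral_cmult_indicator) (auto simp: joint mult_ac)
    finally show ?thesis
      by (simp add: nn_integral_cmult)
  qed
  have "(\<integral>\<^sup>+\<omega>. f (Z (Suc t) \<omega>) * indicator ?E \<omega> \<partial>Pr z) =
      (\<integral>\<^sup>+\<omega>. \<integral>\<^sup>+p. f (Z (Suc t) \<omega>) * indicator (cyl p) \<omega> \<partial>count_space paths \<partial>Pr z)"
    by (intro nn_integral_cong split)
  also have "\<dots> = (\<integral>\<^sup>+p. emeasure (Pr z) (cyl p) * ?g (p t) \<partial>count_space paths)"
    by (subst nn_integral_count_space_nn_integral[OF countable]) (auto simp: next_value)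
  also have "\<dots> = (\<integral>\<^sup>+p. \<integral>\<^sup>+\<omega>. ?g (Z t \<omega>) * indicator (cyl p) \<omega> \<partial>Pr z \<partial>count_space paths)"
  proof (intro nn_integral_cong)
    fix p
    have "(\<integral>\<^sup>+\<omega>. ?g (Z t \<omega>) * indicator (cyl p) \<omega> \<partial>Pr z) = (\<integral>\<^sup>+\<omega>. ?g (p t) * indicator (cyl p) \<omega> \<partial>Pr z)"
      by (intro nn_integral_cong) (auto simp: cyl_def indicator_def)
    also have "\<dots> = ?g (p t) * emeasure (Pr z) (cyl p)"
      by (rule nn_integral_cmult_indicator) (rule cyl)
    finally show "emeasure (Pr z) (cyl p) * ?g (p t) = (\<integral>\<^sup>+\<omega>. ?g (Z t \<omega>) * indicator (cyl p) \<omega> \<partial>Pr z)"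
      by (simp only: mult.commute)
  qed
  also have "\<dots> = (\<integral>\<^sup>+\<omega>. \<integral>\<^sup>+p. ?g (Z t \<omega>) * indicator (cyl p) \<omega> \<partial>count_space paths \<partial>Pr z)"
    by (subst nn_integral_count_space_nn_integral[OF countable])
      (auto intro!: borel_measurable_times_ennreal measurable_compose[OF Z])
  also have "\<dots> = (\<integral>\<^sup>+\<omega>. ?g (Z t \<omega>) * indicator ?E \<omega> \<partial>Pr z)"
    by (intro nn_integral_cong split[symmetric])
  finally show ?thesis .
qed

text \<open>
  This is \<open>\<tau> = \<Sum>t. 1[\<tau> > t]\<close>; the inequality suffices because only upper bounds on the mean of \<open>\<tau>\<close> are
  sought.
\<close>

lemma return_time_le_suminf:
  "return_time Z z \<omega> \<le> (\<Sum>t. indicator {\<omega>. \<forall>s\<in>{1..t}. Z s \<omega> \<noteq> z} \<omega>)"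
proof (cases "\<exists>t\<ge>1. Z t \<omega> = z")
  case True
  define T where "T = (LEAST t. 1 \<le> t \<and> Z t \<omega> = z)"
  have T: "1 \<le> T" "Z T \<omega> = z"
    using LeastI_ex[of "\<lambda>t. 1 \<le> t \<and> Z t \<omega> = z"] True by (auto simp: T_def)
  have before: "Z s \<omega> \<noteq> z" if "1 \<le> s" "s < T" for s
    using that not_less_Least[of s "\<lambda>t. 1 \<le> t \<and> Z t \<omega> = z"] by (auto simp: T_def)
  have "return_time Z z \<omega> \<le> of_nat T"
    unfolding return_time_def using T by (intro INF_lower) auto
  also have "\<dots> = (\<Sum>t<T. indicator {\<omega>. \<forall>s\<in>{1..t}. Z s \<omega> \<noteq> z} \<omega>)"
    using before by simp
  also have "\<dots> \<le> (\<Sum>t. indicator {\<omega>. \<forall>s\<in>{1..t}. Z s \<omega> \<noteq> z} \<omega>)"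
    by (intro sum_le_suminf) auto
  finally show ?thesis .
next
  case False
  then have one: "indicator {\<omega>. \<forall>s\<in>{1..t}. Z s \<omega> \<noteq> z} \<omega> = (1 :: ennreal)" for t
    by auto
  define S :: ennreal where "S = (\<Sum>t. indicator {\<omega>. \<forall>s\<in>{1..t}. Z s \<omega> \<noteq> z} \<omega>)"
  have large: "of_nat n \<le> S" for n
    using sum_le_suminf[of "\<lambda>t. indicator {\<omega>. \<forall>s\<in>{1..t}. Z s \<omega> \<noteq> z} \<omega> :: ennreal" "{..<n}"]
    unfolding S_def one by simp
  have "\<not> S < top"
  proof
    assume "S < top"
    then obtain n where "S < of_nat n" using ennreal_Ex_less_of_nat by blast
    with large[of n] show False by simp
  qed
  then have "S = top" by (simp add: less_top[symmetric])
  then show ?thesis by (simp add: S_def)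
qed

text \<open>
  Write \<open>w\<^sub>t\<close> for the mean of \<open>W (Z t)\<close> on the event \<open>E\<^sub>t\<close> that \<open>z\<close> is avoided at the times \<open>1, \<dots>, t\<close>.
  For \<open>t \<ge> 1\<close> the chain is off \<open>z\<close> on \<open>E\<^sub>t\<close>, so the drift condition gives \<open>w\<^sub>t\<^sub>+\<^sub>1 + P(E\<^sub>t) \<le> w\<^sub>t\<close>.
  Summing over \<open>t\<close> bounds the mean return time by \<open>1 + w\<^sub>1\<close>, and \<open>w\<^sub>1\<close> is finite because a single step
  out of \<open>z\<close> reaches finitely many states.
\<close>

lemma foster_criterion:
  fixes A :: "'s::countable \<Rightarrow> 's \<Rightarrow> real" and W :: "'s \<Rightarrow> real"
  assumes mc: "markov_chain A Pr Z" and nonneg: "\<And>x y. 0 \<le> A x y"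
    and fin: "\<And>x. finite (D x)" and supp: "\<And>x y. y \<notin> D x \<Longrightarrow> A x y = 0"
    and W: "\<And>x. 0 \<le> W x"
    and drift: "\<And>x. x \<noteq> z \<Longrightarrow> (\<Sum>y\<in>D x. A x y * W y) + 1 \<le> W x"
  shows "(\<integral>\<^sup>+\<omega>. return_time Z z \<omega> \<partial>Pr z) < \<infinity>"
proof -
  interpret prob_space "Pr z" using mc by (simp add: markov_chain_def)
  have Z [measurable]: "Z t \<in> Pr z \<rightarrow>\<^sub>M count_space UNIV" for t
    using mc by (simp add: markov_chain_def)
  define E where "E t = {\<omega>. \<forall>s\<in>{1..t}. Z s \<omega> \<noteq> z}" for t
  have E [measurable]: "E t \<inter> space (Pr z) \<in> sets (Pr z)" for t
  proof -
    have "{\<omega> \<in> space (Pr z). \<forall>s\<in>{1..t}. Z s \<omega> \<noteq> z} \<in> sets (Pr z)" by measurable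
    then show ?thesis by (simp add: E_def Int_def conj_commute)
  qed
  have ind [measurable]: "(indicator (E t) :: _ \<Rightarrow> ennreal) \<in> borel_measurable (Pr z)" for t
    using E by (simp add: borel_measurable_indicator_iff)
  have W' [measurable]: "(\<lambda>\<omega>. g (Z t \<omega>)) \<in> borel_measurable (Pr z)" for g :: "'s \<Rightarrow> ennreal" and t
    by (rule measurable_compose[OF Z]) simp
  define AW where "AW x = (\<integral>\<^sup>+y. ennreal (A x y) * ennreal (W y) \<partial>count_space UNIV)" for x
  have AW: "AW x = ennreal (\<Sum>y\<in>D x. A x y * W y)" for x
  proof -
    have "AW x = (\<Sum>y\<in>D x. ennreal (A x y) * ennreal (W y))"
      unfolding AW_def by (intro nn_integral_count_space') (auto simp: fin supp)
    then show ?thesis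
      using W nonneg by (simp add: ennreal_mult[symmetric] sum_ennreal)
  qed
  define w where "w t = (\<integral>\<^sup>+\<omega>. ennreal (W (Z t \<omega>)) * indicator (E t) \<omega> \<partial>Pr z)" for t
  define h where "h t = (\<integral>\<^sup>+\<omega>. indicator (E t) \<omega> \<partial>Pr z)" for t
  have step: "w (Suc t) \<le> (\<integral>\<^sup>+\<omega>. AW (Z t \<omega>) * indicator (E t) \<omega> \<partial>Pr z)" for t
  proof -
    have E_eq: "E t = {\<omega>. \<forall>s\<le>t. (\<lambda>s x. 1 \<le> s \<longrightarrow> x \<noteq> z) s (Z s \<omega>)}"
      by (auto simp: E_def)
    have "w (Suc t) \<le> (\<integral>\<^sup>+\<omega>. ennreal (W (Z (Suc t) \<omega>)) * indicator (E t) \<omega> \<partial>Pr z)"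
      unfolding w_def E_def by (intro nn_integral_mono mult_left_mono) (auto simp: indicator_def)
    also have "\<dots> = (\<integral>\<^sup>+\<omega>. AW (Z t \<omega>) * indicator (E t) \<omega> \<partial>Pr z)"
      unfolding E_eq AW_def
      using markov_chain_step[OF mc nonneg, where f = "\<lambda>y. ennreal (W y)" and t = t
          and Q = "\<lambda>s x. 1 \<le> s \<longrightarrow> x \<noteq> z" and z = z] by simp
    finally show ?thesis .
  qed
  have start: "w 1 \<le> AW z"
  proof -
    have "AE \<omega> in Pr z. Z 0 \<omega> = z" using mc by (simp add: markov_chain_def)
    then have "(\<integral>\<^sup>+\<omega>. AW (Z 0 \<omega>) * indicator (E 0) \<omega> \<partial>Pr z) \<le> (\<integral>\<^sup>+\<omega>. AW z \<partial>Pr z)"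
      by (intro nn_integral_mono_AE) (auto simp: indicator_def)
    with step[of 0] show ?thesis by (simp add: emeasure_space_1)
  qed
  have decrease: "w (Suc (Suc t)) + h (Suc t) \<le> w (Suc t)" for t
  proof -
    have "w (Suc (Suc t)) + h (Suc t) \<le>
        (\<integral>\<^sup>+\<omega>. AW (Z (Suc t) \<omega>) * indicator (E (Suc t)) \<omega> \<partial>Pr z) + h (Suc t)"
      by (intro add_right_mono step)
    also have "\<dots> = (\<integral>\<^sup>+\<omega>. AW (Z (Suc t) \<omega>) * indicator (E (Suc t)) \<omega> + indicator (E (Suc t)) \<omega> \<partial>Pr z)"
      unfolding h_def by (subst nn_integral_add) auto
    also have "\<dots> \<le> w (Suc t)"
      unfolding w_def
    proof (intro nn_integral_mono)
      fix \<omega>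
      show "AW (Z (Suc t) \<omega>) * indicator (E (Suc t)) \<omega> + indicator (E (Suc t)) \<omega>
          \<le> ennreal (W (Z (Suc t) \<omega>)) * indicator (E (Suc t)) \<omega>"
      proof (cases "\<omega> \<in> E (Suc t)")
        case True
        then have "Z (Suc t) \<omega> \<noteq> z" by (auto simp: E_def)
        then have "ennreal ((\<Sum>y\<in>D (Z (Suc t) \<omega>). A (Z (Suc t) \<omega>) y * W y) + 1) \<le> ennreal (W (Z (Suc t) \<omega>))"
          by (intro ennreal_leI drift)
        then show ?thesis
          using True W nonneg by (simp add: AW ennreal_plus sum_nonneg)
      qed simp
    qed
    finally show ?thesis .
  qed
  have partial: "w (Suc n) + (\<Sum>t<n. h (Suc t)) \<le> w 1" for n
  proof (induction n)
    case (Suc n)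
    have "w (Suc (Suc n)) + (\<Sum>t<Suc n. h (Suc t)) = (w (Suc (Suc n)) + h (Suc n)) + (\<Sum>t<n. h (Suc t))"
      by (simp add: ac_simps)
    also have "\<dots> \<le> w (Suc n) + (\<Sum>t<n. h (Suc t))"
      by (intro add_right_mono decrease)
    also note Suc
    finally show ?case .
  qed simp
  have "(\<integral>\<^sup>+\<omega>. return_time Z z \<omega> \<partial>Pr z) \<le> (\<integral>\<^sup>+\<omega>. (\<Sum>t. indicator (E t) \<omega>) \<partial>Pr z)"
    unfolding E_def by (intro nn_integral_mono return_time_le_suminf)
  also have "\<dots> = (\<Sum>t. h t)"
    unfolding h_def by (rule nn_integral_suminf) simp
  also have "\<dots> = h 0 + (\<Sum>t. h (Suc t))"
    using suminf_offset[of h 1] by (simp add: add.commute)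
  also have "\<dots> \<le> 1 + w 1"
  proof (intro add_mono)
    show "h 0 \<le> 1" by (simp add: h_def E_def emeasure_space_1)
    show "(\<Sum>t. h (Suc t)) \<le> w 1"
    proof (intro suminf_le_const)
      fix n show "(\<Sum>t<n. h (Suc t)) \<le> w 1"
        using partial[of n] by (meson add_increasing order_trans order_refl zero_le)
    qed simp
  qed
  also have "\<dots> < \<infinity>"
    using start by (auto simp: AW less_top[symmetric] top_unique)
  finally show ?thesis .
qed

section \<open>Recurrence from drift towards a finite set\<close>

text \<open>
  \<open>D x\<close> stands for a finite set containing the successors of \<open>x\<close>, which keeps the one-step averages finite
  sums.  The target \<open>z\<close> is absorbing, so the value counts paths that hit \<open>z\<close> within \<open>k\<close> steps.
\<close>

fun hitting_prob :: "('s \<Rightarrow> 's \<Rightarrow> real) \<Rightarrow> ('s \<Rightarrow> 's set) \<Rightarrow> 's \<Rightarrow> nat \<Rightarrow> 's \<Rightarrow> real" where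
  "hitting_prob A D z 0 x = (if x = z then 1 else 0)"
| "hitting_prob A D z (Suc k) x = (if x = z then 1 else \<Sum>y\<in>D x. A x y * hitting_prob A D z k y)"

text \<open>
  Drift towards \<open>L\<close> controls only the time to reach \<open>L\<close>.  Off \<open>z\<close> one step turns \<open>g k\<close> into
  \<open>g (Suc k)\<close>, so \<open>U = \<Sum>k<m. 1 - g k\<close> never drifts upwards there and loses at least \<open>Min (g m)\<close> on
  \<open>L\<close>.  Adding a large multiple of \<open>U\<close> to \<open>V / \<epsilon>\<close> makes the drift at most \<open>-1\<close> on \<open>L\<close> as well.
\<close>

lemma positive_recurrence_from_finite_set:
  fixes A :: "'s::countable \<Rightarrow> 's \<Rightarrow> real" and V :: "'s \<Rightarrow> real"
  assumes mc: "markov_chain A Pr Z" and nonneg: "\<And>x y. 0 \<le> A x y"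
    and fin: "\<And>x. finite (D x)" and supp: "\<And>x y. y \<notin> D x \<Longrightarrow> A x y = 0"
    and rows: "\<And>x. (\<Sum>y\<in>D x. A x y) = 1"
    and V: "\<And>x. 0 \<le> V x" and L: "finite L" and \<epsilon>: "0 < \<epsilon>"
    and drift: "\<And>x. x \<notin> L \<Longrightarrow> (\<Sum>y\<in>D x. A x y * V y) + \<epsilon> \<le> V x"
    and reach: "\<And>x z. x \<in> L \<Longrightarrow> (x, z) \<in> {(x, y). 0 < A x y}\<^sup>*"
  shows "positive_recurrent Pr Z"
  unfolding positive_recurrent_def
proof
  fix z
  define g where "g = hitting_prob A D z"
  have g0: "g 0 x = (if x = z then 1 else 0)"
    and gSuc: "g (Suc k) x = (if x = z then 1 else \<Sum>y\<in>D x. A x y * g k y)" for k x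
    by (simp_all add: g_def)
  have g_nonneg: "0 \<le> g k x" for k x
    by (induction k arbitrary: x) (auto simp: g0 gSuc nonneg intro!: sum_nonneg)
  have g_le: "g k x \<le> 1" for k x
  proof (induction k arbitrary: x)
    case (Suc k)
    have "(\<Sum>y\<in>D x. A x y * g k y) \<le> (\<Sum>y\<in>D x. A x y * 1)"
      by (intro sum_mono mult_left_mono Suc nonneg)
    then show ?case by (simp add: gSuc rows)
  qed (simp add: g0)
  have "g k x \<le> g (Suc k) x" for k x
  proof (induction k arbitrary: x)
    case 0
    show ?case by (auto simp: g0 gSuc nonneg intro!: sum_nonneg)
  next
    case (Suc k)
    then show ?case by (subst (1 2) gSuc) (auto intro!: sum_mono mult_left_mono nonneg)
  qed
  then have g_mono: "g k x \<le> g l x" if "k \<le> l" for k l x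
    using that by (rule lift_Suc_mono_le[where f = "\<lambda>k. g k x"])
  have "\<exists>k. 0 < g k x" if "(x, z) \<in> {(x, y). 0 < A x y}\<^sup>*" for x
    using that
  proof (induction rule: converse_rtrancl_induct)
    case base
    show ?case by (rule exI[of _ 0]) (simp add: g0)
  next
    case (step x y)
    then obtain k where k: "0 < g k y" and xy: "0 < A x y" by auto
    have "y \<in> D x" using supp[of y x] xy by auto
    then have "A x y * g k y \<le> (\<Sum>y\<in>D x. A x y * g k y)"
      by (intro member_le_sum) (auto simp: fin nonneg g_nonneg)
    with k xy have "0 < g (Suc k) x"
      by (auto simp: gSuc intro: less_le_trans[OF mult_pos_pos])
    then show ?case by blast
  qed
  then have "\<forall>x\<in>L. \<exists>k. 0 < g k x" using reach by blast
  then obtain K where K: "\<And>x. x \<in> L \<Longrightarrow> 0 < g (K x) x" by metis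
  define m where "m = Max (insert 0 (K ` L))"
  have gm: "0 < g m x" if "x \<in> L" for x
    using K[OF that] g_mono[of "K x" m x] L that by (force simp: m_def)
  define \<delta> where "\<delta> = Min (insert 1 (g m ` L))"
  have \<delta>: "0 < \<delta>" "\<And>x. x \<in> L \<Longrightarrow> \<delta> \<le> g m x"
    using L gm by (auto simp: \<delta>_def)
  define U where "U x = (\<Sum>k<m. 1 - g k x)" for x
  have U: "0 \<le> U x" for x
    by (simp add: U_def g_le sum_nonneg)
  have U_drift: "(\<Sum>y\<in>D x. A x y * U y) = U x - g m x" if "x \<noteq> z" for x
  proof -
    have "(\<Sum>y\<in>D x. A x y * U y) = (\<Sum>k<m. \<Sum>y\<in>D x. A x y * (1 - g k y))"
      unfolding U_def sum_distrib_left by (rule sum.swap)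
    also have "\<dots> = (\<Sum>k<m. 1 - g (Suc k) x)"
      using that by (simp add: gSuc right_diff_distrib sum_subtractf rows)
    also have "\<dots> = U x - (\<Sum>k<m. g (Suc k) x - g k x)"
      unfolding U_def sum_subtractf[symmetric] by simp
    also have "\<dots> = U x - g m x"
      using that sum_lessThan_telescope[of "\<lambda>k. g k x" m] by (simp add: g0)
    finally show ?thesis .
  qed
  \<comment> \<open>\<open>B\<close> bounds the drift of \<open>V\<close> on \<open>L\<close>; the inserted 0 covers an empty \<open>L\<close> and makes \<open>B \<ge> 0\<close>.\<close>
  define B where "B = Max (insert 0 ((\<lambda>x. (\<Sum>y\<in>D x. A x y * V y) - V x) ` L))"
  have B: "0 \<le> B" "\<And>x. x \<in> L \<Longrightarrow> (\<Sum>y\<in>D x. A x y * V y) - V x \<le> B"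
    using L by (auto simp: B_def)
  \<comment> \<open>On \<open>L\<close> the gain \<open>b * \<delta>\<close> pays for the drift \<open>B / \<epsilon>\<close> of \<open>V / \<epsilon>\<close> and leaves 1.\<close>
  define b where "b = (1 + B / \<epsilon>) / \<delta>"
  have b: "0 \<le> b" "b * \<delta> = 1 + B / \<epsilon>"
    using B \<epsilon> \<delta> by (auto simp: b_def)
  define W where "W x = V x / \<epsilon> + b * U x" for x
  have W_drift: "(\<Sum>y\<in>D x. A x y * W y) + 1 \<le> W x" if "x \<noteq> z" for x
  proof -
    have "A x y * W y = A x y * V y / \<epsilon> + b * (A x y * U y)" for y
      by (simp add: W_def distrib_left)
    then have "(\<Sum>y\<in>D x. A x y * W y) = (\<Sum>y\<in>D x. A x y * V y / \<epsilon>) + (\<Sum>y\<in>D x. b * (A x y * U y))"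
      by (simp only: sum.distrib)
    then have AW: "(\<Sum>y\<in>D x. A x y * W y) = (\<Sum>y\<in>D x. A x y * V y) / \<epsilon> + b * (U x - g m x)"
      by (simp only: U_drift[OF that] sum_divide_distrib[symmetric] sum_distrib_left[symmetric])
    show ?thesis
    proof (cases "x \<in> L")
      case True
      have "((\<Sum>y\<in>D x. A x y * V y) - V x) / \<epsilon> \<le> B / \<epsilon>"
        using B(2)[OF True] \<epsilon> by (simp add: divide_right_mono)
      moreover have "b * \<delta> \<le> b * g m x"
        using \<delta>(2)[OF True] b(1) by (rule mult_left_mono)
      ultimately show ?thesis
        unfolding AW unfolding W_def using b by (simp add: diff_divide_distrib right_diff_distrib)
    next
      case False
      have "((\<Sum>y\<in>D x. A x y * V y) + \<epsilon>) / \<epsilon> \<le> V x / \<epsilon>"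
        using drift[OF False] \<epsilon> by (intro divide_right_mono) auto
      moreover have "0 \<le> b * g m x" using b g_nonneg by simp
      ultimately show ?thesis
        unfolding AW unfolding W_def using \<epsilon> by (simp add: add_divide_distrib right_diff_distrib)
    qed
  qed
  have W_nonneg: "0 \<le> W x" for x
    using V U b \<epsilon> by (simp add: W_def)
  show "(\<integral>\<^sup>+\<omega>. return_time Z z \<omega> \<partial>Pr z) < \<infinity>"
    by (rule foster_criterion[where A = A and D = D and W = W, OF mc nonneg fin supp W_nonneg W_drift])
qed

section \<open>Positive stochastic matrices\<close>

text \<open>
  Maximum principle: at a maximal entry the average of \<open>h\<close> over all entries, with positive weights,
  equals the maximum.
\<close>

lemma positive_stochastic_harmonic_const:
  fixes P :: "real ^ 'n ^ 'n"
  assumes stoch: "stochastic_matrix P" and pos: "\<And>i j. 0 < P $ i $ j" and h: "P *v h = h"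
  shows "h $ i = h $ j"
proof -
  obtain m where m: "\<And>j. h $ j \<le> h $ m"
  proof -
    have "Max (range (($) h)) \<in> range (($) h)" by (intro Max_in) auto
    then obtain m where "h $ m = Max (range (($) h))" by (metis imageE)
    then show thesis by (intro that[of m]) simp
  qed
  have "(\<Sum>j\<in>UNIV. P $ m $ j * (h $ m - h $ j)) = h $ m * (\<Sum>j\<in>UNIV. P $ m $ j) - (P *v h) $ m"
    by (simp add: matrix_vector_mult_def right_diff_distrib sum_subtractf sum_distrib_left mult.commute)
  also have "\<dots> = 0"
    using stoch by (simp add: h stochastic_matrix_def)
  finally have "\<forall>j\<in>UNIV. P $ m $ j * (h $ m - h $ j) = 0"
    using m pos by (subst (asm) sum_nonneg_eq_0_iff) (auto intro!: mult_nonneg_nonneg intro: less_imp_le)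
  then have "h $ j = h $ m" for j
    using pos[of m j] by (metis UNIV_I eq_iff_diff_eq_0 less_irrefl mult_eq_0_iff)
  then show ?thesis by metis
qed

text \<open>
  The kernel of \<open>I - P\<close> consists of the constants, and adding the rank-one matrix \<open>1 \<pi>\<close> removes it: the
  sum \<open>f\<close> is invertible and agrees with \<open>I - P\<close> on the vectors orthogonal to \<open>\<pi>\<close>.  The preimage of \<open>g\<close>
  is such a vector because \<open>\<pi> \<bullet> f h = \<pi> \<bullet> h\<close>.
\<close>

lemma poisson_equation:
  fixes P :: "real ^ 'n ^ 'n"
  assumes stoch: "stochastic_matrix P" and pos: "\<And>i j. 0 < P $ i $ j"
    and \<pi>: "(\<Sum>i\<in>UNIV. \<pi> $ i) = 1" "\<pi> v* P = \<pi>" and g: "\<pi> \<bullet> g = 0"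
  obtains h where "h - P *v h = g"
proof -
  define f where "f h = h - P *v h + (\<pi> \<bullet> h) *\<^sub>R (\<chi> i. 1)" for h
  have lin: "linear f"
    unfolding f_def
    by (rule linearI) (simp_all add: matrix_vector_right_distrib matrix_vector_mult_scaleR
        inner_add_right algebra_simps)
  have one: "\<pi> \<bullet> (\<chi> i. 1) = 1"
    using \<pi>(1) by (simp add: inner_vec_def)
  have \<pi>f: "\<pi> \<bullet> f h = \<pi> \<bullet> h" for h
    by (simp add: f_def inner_add_right inner_diff_right one dot_lmul_matrix[symmetric] \<pi>(2))
  have "h = 0" if "f h = 0" for h
  proof -
    have \<pi>h: "\<pi> \<bullet> h = 0" using \<pi>f[of h] that by simp
    then have "P *v h = h" using that by (simp add: f_def)
    then have "h $ i = h $ j" for i j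
      by (rule positive_stochastic_harmonic_const[OF stoch pos])
    then obtain c where c: "\<And>i. h $ i = c" by metis
    then have "\<pi> \<bullet> h = c" using \<pi>(1) by (simp add: inner_vec_def sum_distrib_right[symmetric])
    with \<pi>h c show ?thesis by (simp add: vec_eq_iff)
  qed
  then have "inj f" using lin by (simp add: linear_injective_0)
  then have "surj f" using lin by (simp add: linear_injective_imp_surjective)
  then obtain h where h: "f h = g" by (metis surjD)
  then have "\<pi> \<bullet> h = 0" using \<pi>f[of h] g by simp
  then show thesis using h that[of h] by (simp add: f_def)
qed

text \<open>
  The constant vector shows that \<open>I - P\<close> is singular, hence so is its transpose.
\<close>

lemma left_fixed_vector_exists:
  fixes P :: "real ^ 'n ^ 'n"
  assumes "stochastic_matrix P"
  obtains \<psi> where "\<psi> \<noteq> 0" "\<psi> v* P = \<psi>"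
proof -
  have "(mat 1 - P) *v (\<chi> i. 1) = 0"
    using assms by (simp add: matrix_vector_mult_diff_rdistrib)
      (simp add: vec_eq_iff matrix_vector_mult_def stochastic_matrix_def)
  moreover have "(\<chi> i. 1) \<noteq> (0 :: real ^ 'n)" by (simp add: vec_eq_iff)
  ultimately have "\<not> inj ((*v) (mat 1 - P))"
    by (metis injD matrix_vector_mult_0_right)
  then have "\<not> inj ((*v) (transpose (mat 1 - P)))"
    unfolding matrix_left_invertible_injective[symmetric] invertible_left_inverse[symmetric]
      invertible_det_nz det_transpose .
  then obtain \<psi> where "\<psi> \<noteq> 0" "transpose (mat 1 - P) *v \<psi> = 0"
    by (auto simp: linear_injective_0[OF matrix_vector_mul_linear])
  then show thesis
    by (intro that[of \<psi>]) (simp_all add: vector_matrix_mult_diff_rdistrib vector_matrix_left_distrib vector_matrix_mul_rid)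
qed

text \<open>
  For a left fixed vector \<open>\<psi>\<close>, the triangle inequality gives \<open>\<bar>\<psi>\<bar> \<le> \<bar>\<psi>\<bar> P\<close>.  Both sides have the same total
  mass, so \<open>\<bar>\<psi>\<bar>\<close> is fixed as well and only needs normalising.
\<close>

lemma stationary_distribution_exists:
  fixes P :: "real ^ 'n ^ 'n"
  assumes stoch: "stochastic_matrix P"
  shows "\<exists>\<pi>. is_stationary_distribution \<pi> P"
proof -
  obtain \<psi> where \<psi>: "\<psi> \<noteq> 0" "\<psi> v* P = \<psi>" by (rule left_fixed_vector_exists[OF stoch])
  have P: "0 \<le> P $ i $ j" "(\<Sum>j\<in>UNIV. P $ i $ j) = 1" for i j
    using stoch by (auto simp: stochastic_matrix_def)
  define s where "s = (\<Sum>i\<in>UNIV. \<bar>\<psi> $ i\<bar>)"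
  have "s \<noteq> 0" using \<psi>(1) by (auto simp: s_def sum_nonneg_eq_0_iff vec_eq_iff)
  then have "0 < s" by (simp add: s_def sum_nonneg less_le)
  have le: "\<bar>\<psi> $ j\<bar> \<le> (\<Sum>i\<in>UNIV. \<bar>\<psi> $ i\<bar> * P $ i $ j)" for j
  proof -
    have "\<psi> $ j = (\<Sum>i\<in>UNIV. \<psi> $ i * P $ i $ j)"
      by (subst \<psi>(2)[symmetric]) (simp add: vector_matrix_mult_def mult.commute)
    also have "\<bar>\<dots>\<bar> \<le> (\<Sum>i\<in>UNIV. \<bar>\<psi> $ i * P $ i $ j\<bar>)" by (rule sum_abs)
    finally show ?thesis using P by (simp add: abs_mult)
  qed
  have "(\<Sum>j\<in>UNIV. \<Sum>i\<in>UNIV. \<bar>\<psi> $ i\<bar> * P $ i $ j) = s"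
    by (subst sum.swap) (simp add: sum_distrib_left[symmetric] P s_def)
  then have "(\<Sum>j\<in>UNIV. (\<Sum>i\<in>UNIV. \<bar>\<psi> $ i\<bar> * P $ i $ j) - \<bar>\<psi> $ j\<bar>) = 0"
    by (simp add: sum_subtractf s_def)
  then have "\<forall>j\<in>UNIV. (\<Sum>i\<in>UNIV. \<bar>\<psi> $ i\<bar> * P $ i $ j) - \<bar>\<psi> $ j\<bar> = 0"
    using le by (subst (asm) sum_nonneg_eq_0_iff) auto
  then have eq: "(\<Sum>i\<in>UNIV. \<bar>\<psi> $ i\<bar> * P $ i $ j) = \<bar>\<psi> $ j\<bar>" for j by simp
  have "is_stationary_distribution (\<chi> i. \<bar>\<psi> $ i\<bar> / s) P"
    unfolding is_stationary_distribution_def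
    using \<open>0 < s\<close> eq
    by (auto simp: sum_divide_distrib[symmetric] s_def[symmetric] vec_eq_iff vector_matrix_mult_def
        mult.commute[of "P $ _ $ _"])
  then show ?thesis by blast
qed

lemma stationary_distribution_inner_one:
  "is_stationary_distribution \<pi> P \<Longrightarrow> \<pi> \<bullet> (\<chi> i. 1) = 1"
  by (simp add: is_stationary_distribution_def inner_vec_def)

text \<open>
  A stationary \<open>\<rho>\<close> annihilates every \<open>h - P h\<close>, and by the Poisson equation these are all the vectors
  orthogonal to \<open>\<pi>\<close>.  Testing with \<open>e\<^sub>i - \<pi>\<^sub>i 1\<close> gives \<open>\<rho>\<^sub>i = \<pi>\<^sub>i\<close>.
\<close>

lemma stationary_distribution_unique:
  fixes P :: "real ^ 'n ^ 'n"
  assumes stoch: "stochastic_matrix P" and pos: "\<And>i j. 0 < P $ i $ j"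
    and \<pi>: "is_stationary_distribution \<pi> P" and \<rho>: "is_stationary_distribution \<rho> P"
  shows "\<rho> = \<pi>"
proof -
  have "\<rho> $ i = \<pi> $ i" for i
  proof -
    define g :: "real ^ 'n" where "g = axis i 1 - (\<pi> $ i) *\<^sub>R (\<chi> i. 1)"
    have inner: "\<sigma> \<bullet> g = \<sigma> $ i - \<pi> $ i" if "is_stationary_distribution \<sigma> P" for \<sigma>
      using stationary_distribution_inner_one[OF that]
      by (simp add: g_def inner_diff_right inner_axis)
    have "\<pi> \<bullet> g = 0" using inner[OF \<pi>] by simp
    then obtain h where h: "h - P *v h = g"
      using poisson_equation[OF stoch pos] \<pi> unfolding is_stationary_distribution_def by metis
    have "\<rho> \<bullet> g = 0"
      using \<rho> by (simp add: h[symmetric] inner_diff_right dot_lmul_matrix[symmetric] is_stationary_distribution_def)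
    then show ?thesis using inner[OF \<rho>] by simp
  qed
  then show ?thesis by (simp add: vec_eq_iff)
qed

section \<open>Quasi-birth-and-death chains with negative mean drift\<close>

lemma qbd_matrix_outside:
  "m \<notin> {n - 1..Suc n} \<Longrightarrow> qbd_matrix B0 B1 Dn Sm Up (n, i) (m, j) = 0"
  by (auto simp: qbd_matrix_def)

lemma sum_qbd_row_boundary:
  "(\<Sum>y\<in>{0 - 1..Suc 0} \<times> UNIV. qbd_matrix B0 B1 Dn Sm Up (0, i) y * f y) =
    (\<Sum>j\<in>UNIV. B0 $ i $ j * f (0, j) + B1 $ i $ j * f (1, j))"
proof -
  have levels: "{0 - 1..Suc 0} = {0, 1 :: nat}" by auto
  show ?thesis
    unfolding sum.cartesian_product' levels
    by (simp add: qbd_matrix_def sum.distrib)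
qed

lemma sum_qbd_row_interior:
  "(\<Sum>y\<in>{Suc n - 1..Suc (Suc n)} \<times> UNIV. qbd_matrix B0 B1 Dn Sm Up (Suc n, i) y * f y) =
    (\<Sum>j\<in>UNIV. Dn $ i $ j * f (n, j) + Sm $ i $ j * f (Suc n, j) + Up $ i $ j * f (Suc (Suc n), j))"
proof -
  have levels: "{Suc n - 1..Suc (Suc n)} = {n, Suc n, Suc (Suc n)}" by auto
  show ?thesis
    unfolding sum.cartesian_product' levels
    by (simp add: qbd_matrix_def sum.distrib add.assoc)
qed

text \<open>
  The mean drift condition of Neuts.  The Poisson equation replaces the phase-dependent drift \<open>d\<close> of the
  level by its stationary average \<open>- \<epsilon>\<close>, at the cost of adding the phase function \<open>h\<close> to the level.
\<close>

theorem qbd_positive_recurrent: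
  fixes B0 B1 Dn Sm Up :: "real ^ 'p ^ 'p" and \<pi> :: "real ^ 'p"
  assumes mc: "markov_chain (qbd_matrix B0 B1 Dn Sm Up) Pr Z"
    and nonneg: "\<And>x y. 0 \<le> qbd_matrix B0 B1 Dn Sm Up x y"
    and boundary: "\<And>i. (\<Sum>j\<in>UNIV. B0 $ i $ j + B1 $ i $ j) = 1"
    and stoch: "stochastic_matrix (Dn + Sm + Up)" and pos: "\<And>i j. 0 < (Dn + Sm + Up) $ i $ j"
    and \<pi>: "is_stationary_distribution \<pi> (Dn + Sm + Up)"
    and drift: "\<pi> \<bullet> (Up *v (\<chi> i. 1)) < \<pi> \<bullet> (Dn *v (\<chi> i. 1))"
    and reach: "\<And>i z. ((0, i), z) \<in> {(x, y). 0 < qbd_matrix B0 B1 Dn Sm Up x y}\<^sup>*"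
  shows "positive_recurrent Pr Z"
proof -
  define A where "A = qbd_matrix B0 B1 Dn Sm Up"
  define D where "D x = {fst x - 1..Suc (fst x)} \<times> (UNIV :: 'p set)" for x :: "nat \<times> 'p"
  define P where "P = Dn + Sm + Up"
  have P_rows: "(\<Sum>j\<in>UNIV. P $ i $ j) = 1" for i
    using stoch by (simp add: stochastic_matrix_def P_def)
  define d where "d = Up *v (\<chi> i. 1) - Dn *v (\<chi> i. 1)"
  define \<epsilon> where "\<epsilon> = - (\<pi> \<bullet> d)"
  have "0 < \<epsilon>"
    using drift by (simp add: \<epsilon>_def d_def inner_diff_right)
  have "\<pi> \<bullet> (d + \<epsilon> *\<^sub>R (\<chi> i. 1)) = 0"
    using stationary_distribution_inner_one[OF \<pi>] by (simp add: \<epsilon>_def inner_diff_right)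
  then obtain h where h: "h - P *v h = d + \<epsilon> *\<^sub>R (\<chi> i. 1)"
    using poisson_equation[OF stoch pos] \<pi> unfolding is_stationary_distribution_def P_def by metis
  then have h_row: "h $ i - (\<Sum>j\<in>UNIV. P $ i $ j * h $ j) = d $ i + \<epsilon>" for i
    by (simp add: vec_eq_iff matrix_vector_mult_def)
  \<comment> \<open>A constant that lifts \<open>h\<close> to a nonnegative function; it does not affect drifts.\<close>
  define H where "H = (\<Sum>j\<in>UNIV. \<bar>h $ j\<bar>)"
  have H: "0 \<le> h $ i + H" for i
    using member_le_sum[of i UNIV "\<lambda>j. \<bar>h $ j\<bar>"] by (simp add: H_def)
  define V where "V x = real (fst x) + (h $ snd x + H)" for x
  have A_rows: "(\<Sum>y\<in>D x. A x y) = 1" for x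
  proof (cases x)
    case (Pair n i)
    show ?thesis
    proof (cases n)
      case 0
      then show ?thesis
        using sum_qbd_row_boundary[of B0 B1 Dn Sm Up i "\<lambda>_. 1"] boundary
        by (simp add: Pair A_def D_def)
    next
      case (Suc m)
      then show ?thesis
        using sum_qbd_row_interior[of B0 B1 Dn Sm Up m i "\<lambda>_. 1"] P_rows[of i]
        by (simp add: Pair A_def D_def P_def)
    qed
  qed
  have V_drift: "(\<Sum>y\<in>D x. A x y * V y) + \<epsilon> \<le> V x" if "x \<notin> {0} \<times> UNIV" for x
  proof -
    obtain n i where x: "x = (Suc n, i)"
      using \<open>x \<notin> {0} \<times> UNIV\<close> by (cases x; cases "fst x") auto
    have "(\<Sum>y\<in>D x. A x y * V y) =
        (\<Sum>j\<in>UNIV. (real (Suc n) + H) * P $ i $ j + P $ i $ j * h $ j + Up $ i $ j - Dn $ i $ j)"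
      unfolding x D_def A_def fst_conv sum_qbd_row_interior
      by (intro sum.cong) (simp_all add: V_def P_def algebra_simps)
    also have "\<dots> = (real (Suc n) + H) * (\<Sum>j\<in>UNIV. P $ i $ j) + (\<Sum>j\<in>UNIV. P $ i $ j * h $ j) + d $ i"
      by (simp only: sum.distrib sum_subtractf sum_distrib_left)
        (simp add: d_def matrix_vector_mult_def)
    also have "\<dots> = V x - \<epsilon>"
      using h_row[of i] by (simp add: P_rows V_def x)
    finally show ?thesis by simp
  qed
  show ?thesis
  proof (rule positive_recurrence_from_finite_set[where A = A and D = D and V = V
        and L = "{0} \<times> UNIV" and \<epsilon> = \<epsilon>])
    show "A x y = 0" if "y \<notin> D x" for x y
      using that unfolding A_def D_def by (cases x; cases y) (simp add: qbd_matrix_outside)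
    show "(x, z) \<in> {(x, y). 0 < A x y}\<^sup>*" if "x \<in> {0} \<times> UNIV" for x z
      using that reach[of "snd x" z] unfolding A_def by auto
  qed (use mc nonneg A_rows V_drift \<open>0 < \<epsilon>\<close> H in \<open>auto simp: A_def D_def V_def\<close>)
qed

section \<open>Transition matrices of the two-server system\<close>

lemma S_tilde_entry:
  "S_tilde sys ctl $ ((k, l), (a, b)) $ ((k', l'), (a', b')) =
    env_matrix sys 1 $ k $ k' * env_matrix sys 2 $ l $ l' *
      (service_prob sys 2 l * (ctl_C ctl $ a $ b * (ctl_N ctl 1 $ a $ a' * ctl_S ctl 2 $ b $ b')) +
       service_prob sys 1 k * ((1 - ctl_C ctl $ a $ b) * (ctl_S ctl 1 $ a $ a' * ctl_N ctl 2 $ b $ b')))"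
  by (simp add: S_tilde_def assemble_def success_block_def diag_vectorize_mult kronecker_def
      complement_matrix_def)

lemma F_tilde_entry:
  "F_tilde sys ctl $ ((k, l), (a, b)) $ ((k', l'), (a', b')) =
    env_matrix sys 1 $ k $ k' * env_matrix sys 2 $ l $ l' *
      ((1 - service_prob sys 2 l) * (ctl_C ctl $ a $ b * (ctl_N ctl 1 $ a $ a' * ctl_F ctl 2 $ b $ b')) +
       (1 - service_prob sys 1 k) * ((1 - ctl_C ctl $ a $ b) * (ctl_F ctl 1 $ a $ a' * ctl_N ctl 2 $ b $ b')))"
  by (simp add: F_tilde_def assemble_def failure_block_def diag_vectorize_mult kronecker_def
      complement_matrix_def)

lemma N_tilde_entry:
  "N_tilde sys ctl $ ((k, l), (a, b)) $ ((k', l'), (a', b')) =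
    env_matrix sys 1 $ k $ k' * env_matrix sys 2 $ l $ l' * (ctl_N ctl 1 $ a $ a' * ctl_N ctl 2 $ b $ b')"
  by (simp add: N_tilde_def assemble_def idle_block_def kronecker_def)

lemma phase_process_eq: "phase_process_matrix lam sys ctl = S_tilde sys ctl + F_tilde sys ctl"
  by (simp add: phase_process_matrix_def A_down_def A_same_def A_up_def vec_eq_iff algebra_simps)

lemma convex_combination_pos:
  fixes c x y :: real
  assumes "0 \<le> c" "c \<le> 1" "0 < x" "0 < y"
  shows "0 < c * x + (1 - c) * y"
proof (cases "c = 0")
  case False
  then show ?thesis using assms by (intro add_pos_nonneg mult_pos_pos mult_nonneg_nonneg) auto
qed (use assms in simp)

lemma env_matrix_pos:
  assumes "valid_system sys" and "j \<in> {1, 2}"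
  shows "0 < env_matrix sys j $ k $ k'"
  using assms by (auto simp: env_matrix_def valid_system_def)

lemma controller_pos:
  assumes "valid_controller ctl" and "j \<in> {1, 2}"
  shows "0 < ctl_N ctl j $ a $ b" "0 < ctl_S ctl j $ a $ b" "0 < ctl_F ctl j $ a $ b"
  using assms by (auto simp: valid_controller_def)

text \<open>
  Each server contributes a convex combination of its success and failure matrices, both positive, and
  the controller's choice is a convex combination of the two servers' contributions.  Even
  where a success probability or an entry of \<open>C\<close> is 0 or 1, something positive remains.
\<close>

lemma phase_process_pos:
  assumes sys: "valid_system sys" and ctl: "valid_controller ctl"
  shows "0 < (S_tilde sys ctl + F_tilde sys ctl) $ i $ j"
proof -
  obtain k l a b where i: "i = ((k, l), (a, b))" by (metis prod.exhaust)
  obtain k' l' a' b' where j: "j = ((k', l'), (a', b'))" by (metis prod.exhaust)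
  have C: "0 \<le> ctl_C ctl $ a $ b" "ctl_C ctl $ a $ b \<le> 1"
    using ctl by (auto simp: valid_controller_def)
  have mu: "0 \<le> service_prob sys 1 k" "service_prob sys 1 k \<le> 1"
    "0 \<le> service_prob sys 2 l" "service_prob sys 2 l \<le> 1"
    using sys by (auto simp: valid_system_def)
  have "(S_tilde sys ctl + F_tilde sys ctl) $ i $ j =
    env_matrix sys 1 $ k $ k' * env_matrix sys 2 $ l $ l' *
      (ctl_C ctl $ a $ b * (ctl_N ctl 1 $ a $ a' *
         (service_prob sys 2 l * ctl_S ctl 2 $ b $ b' + (1 - service_prob sys 2 l) * ctl_F ctl 2 $ b $ b')) +
       (1 - ctl_C ctl $ a $ b) * (ctl_N ctl 2 $ b $ b' *
         (service_prob sys 1 k * ctl_S ctl 1 $ a $ a' + (1 - service_prob sys 1 k) * ctl_F ctl 1 $ a $ a')))"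
    by (simp add: i j S_tilde_entry F_tilde_entry algebra_simps)
  also have "0 < \<dots>"
    by (intro mult_pos_pos convex_combination_pos env_matrix_pos controller_pos C mu sys ctl) auto
  finally show ?thesis .
qed

text \<open>
  Nonnegativity and row sums come from the entries being the probabilities of a one-slot law.
\<close>

lemma queue_matrix_nonneg:
  assumes "0 < lam" "lam < 1" "valid_system sys" "valid_controller ctl"
  shows "0 \<le> queue_matrix lam sys ctl x y"
  by (simp add: pmf_slot[OF assms, symmetric])

lemma queue_matrix_row_sum:
  assumes "0 < lam" "lam < 1" "valid_system sys" "valid_controller ctl"
  shows "(\<Sum>y\<in>{n - 1..Suc n} \<times> UNIV. queue_matrix lam sys ctl (n, i) y) = 1"
  unfolding pmf_slot[OF assms, symmetric]
proof (rule sum_pmf_eq_1)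
  show "set_pmf (slot lam sys ctl (n, i)) \<subseteq> {n - 1..Suc n} \<times> UNIV"
  proof
    fix y assume "y \<in> set_pmf (slot lam sys ctl (n, i))"
    then have "queue_matrix lam sys ctl (n, i) y \<noteq> 0"
      by (simp add: set_pmf_iff pmf_slot[OF assms])
    moreover have "queue_matrix lam sys ctl (n, i) (fst y, snd y) = 0" if "fst y \<notin> {n - 1..Suc n}"
      unfolding queue_matrix_def using that by (rule qbd_matrix_outside)
    ultimately show "y \<in> {n - 1..Suc n} \<times> UNIV"
      by (cases y) auto
  qed
qed simp

text \<open>
  A row of \<open>S + F\<close> lists, by the next phase, the transition probabilities out of a state of level 1; since \<open>\<lambda>\<close> cancels, any
  value in \<open>(0, 1)\<close> may be used to see this.
\<close>

lemma stochastic_phase_process: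
  fixes ctl :: "('m::finite) controller"
  assumes sys: "valid_system sys" and ctl: "valid_controller ctl"
  shows "stochastic_matrix (S_tilde sys ctl + F_tilde sys ctl)"
  unfolding stochastic_matrix_def
proof (intro conjI allI)
  fix i j :: "'m phase"
  show "0 \<le> (S_tilde sys ctl + F_tilde sys ctl) $ i $ j"
    using phase_process_pos[OF sys ctl] by (rule less_imp_le)
  have "1 = (\<Sum>y\<in>{Suc 0 - 1..Suc (Suc 0)} \<times> UNIV. queue_matrix (1 / 2) sys ctl (Suc 0, i) y * 1)"
    using queue_matrix_row_sum[of "1 / 2" sys ctl "Suc 0" i] sys ctl by simp
  also have "\<dots> = (\<Sum>j\<in>UNIV. phase_process_matrix (1 / 2) sys ctl $ i $ j)"
    unfolding queue_matrix_def sum_qbd_row_interior by (simp add: phase_process_matrix_def)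
  finally show "(\<Sum>j\<in>UNIV. (S_tilde sys ctl + F_tilde sys ctl) $ i $ j) = 1"
    by (simp add: phase_process_eq)
qed

lemma N_tilde_pos:
  assumes "valid_system sys" "valid_controller ctl"
  shows "0 < N_tilde sys ctl $ i $ j"
  using assms
  by (cases i rule: prod.exhaust; cases j rule: prod.exhaust)
    (auto simp: N_tilde_entry intro!: mult_pos_pos env_matrix_pos controller_pos)

text \<open>
  A row of the failure matrix vanishes if the selected server never fails in the current environment.
  This cannot happen when both environments are in state 0, because
  there the first server succeeds less often than in its state 1, so with probability below 1, and the
  second server succeeds no more often than the first.
\<close>

lemma F_tilde_pos:
  assumes sys: "valid_system sys" and ctl: "valid_controller ctl"
  shows "0 < F_tilde sys ctl $ ((False, False), (a, b)) $ j"
proof -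
  obtain k' l' a' b' where j: "j = ((k', l'), (a', b'))" by (metis prod.exhaust)
  have C: "0 \<le> ctl_C ctl $ a $ b" "ctl_C ctl $ a $ b \<le> 1"
    using ctl by (auto simp: valid_controller_def)
  have mu1: "service_prob sys 1 False < 1"
    using sys unfolding valid_system_def by (metis insertI1 order_less_le_trans)
  then have mu2: "service_prob sys 2 False < 1"
    using sys unfolding valid_system_def by auto
  have "F_tilde sys ctl $ ((False, False), (a, b)) $ j =
    env_matrix sys 1 $ False $ k' * env_matrix sys 2 $ False $ l' *
      (ctl_C ctl $ a $ b * ((1 - service_prob sys 2 False) * (ctl_N ctl 1 $ a $ a' * ctl_F ctl 2 $ b $ b')) +
       (1 - ctl_C ctl $ a $ b) * ((1 - service_prob sys 1 False) * (ctl_F ctl 1 $ a $ a' * ctl_N ctl 2 $ b $ b')))"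
    by (simp add: j F_tilde_entry mult.left_commute)
  also have "0 < \<dots>"
    using mu1 mu2
    by (intro mult_pos_pos convex_combination_pos env_matrix_pos controller_pos C sys ctl) auto
  finally show ?thesis .
qed

text \<open>
  The queue climbs one level at a time, always through a phase with both environments in state 0; the
  positive failure rows there lead to every phase of the next level.
\<close>

lemma reachable_from_empty_queue:
  fixes ctl :: "('m::finite) controller"
  assumes lam: "0 < lam" "lam < 1" and sys: "valid_system sys" and ctl: "valid_controller ctl"
  shows "((0, i), (n, j)) \<in> {(x, y). 0 < queue_matrix lam sys ctl x y}\<^sup>*"
proof (induction n arbitrary: j)
  case 0
  have "0 < queue_matrix lam sys ctl (0, i) (0, j)"
    using lam N_tilde_pos[OF sys ctl] by (simp add: queue_matrix_def qbd_matrix_def)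
  then show ?case by blast
next
  case (Suc n)
  fix a b :: 'm
  have "0 < queue_matrix lam sys ctl (n, ((False, False), (a, b))) (Suc n, j)"
    using lam N_tilde_pos[OF sys ctl] F_tilde_pos[OF sys ctl]
    by (simp add: queue_matrix_def qbd_matrix_def A_up_def)
  then show ?case
    using Suc[of "((False, False), (a, b))"] by (auto intro: rtrancl_into_rtrancl)
qed

section \<open>Stability of the two-server queue\<close>

theorem mainTheorem2:
  fixes lam :: real
    and sys :: system
    and ctl :: "('m::finite) controller"
    and Pr :: "nat \<times> 'm phase \<Rightarrow> 'w measure"
    and Z :: "nat \<Rightarrow> 'w \<Rightarrow> nat \<times> 'm phase"
  assumes "0 < lam" and "lam < 1"
    and "valid_system sys"
    and "valid_controller ctl"
    and "markov_chain (queue_matrix lam sys ctl) Pr Z"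
  shows "stochastic_matrix (phase_process_matrix lam sys ctl)
    \<and> (\<exists>!\<pi>. is_stationary_distribution \<pi> (phase_process_matrix lam sys ctl))
    \<and> is_stationary_distribution (pi_inf lam sys ctl) (S_tilde sys ctl + F_tilde sys ctl)
    \<and> (\<forall>\<pi>. is_stationary_distribution \<pi> (S_tilde sys ctl + F_tilde sys ctl)
           \<longrightarrow> \<pi> = pi_inf lam sys ctl)
    \<and> (\<forall>lam'. 0 < lam' \<and> lam' < 1 \<longrightarrow>
         pi_inf lam' sys ctl = pi_inf lam sys ctl \<and> mu_star lam' sys ctl = mu_star lam sys ctl)
    \<and> (lam < mu_star lam sys ctl \<longrightarrow> positive_recurrent Pr Z)"
proof -
  note lam = assms(1,2) and sys = assms(3) and ctl = assms(4) and mc = assms(5)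
  define P where "P = S_tilde sys ctl + F_tilde sys ctl"
  have P: "phase_process_matrix lam' sys ctl = P" for lam'
    by (simp add: P_def phase_process_eq)
  have stoch: "stochastic_matrix P"
    unfolding P_def by (rule stochastic_phase_process[OF sys ctl])
  have pos: "0 < P $ i $ j" for i j
    unfolding P_def by (rule phase_process_pos[OF sys ctl])
  have ex1: "\<exists>!\<pi>. is_stationary_distribution \<pi> P"
    using stationary_distribution_exists[OF stoch] stationary_distribution_unique[OF stoch pos] by blast
  define \<pi> where "\<pi> = pi_inf lam sys ctl"
  have pi_inf: "pi_inf lam' sys ctl = \<pi>" for lam'
    by (simp add: \<pi>_def pi_inf_def P)
  have \<pi>: "is_stationary_distribution \<pi> P"
    unfolding \<pi>_def pi_inf_def P by (rule theI'[OF ex1])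
  have mu_star: "mu_star lam' sys ctl = \<pi> \<bullet> (S_tilde sys ctl *v (\<chi> i. 1))" for lam'
    by (simp add: mu_star_def pi_inf dot_lmul_matrix)
  have "positive_recurrent Pr Z" if stable: "lam < mu_star lam sys ctl"
  proof -
    define N where "N = N_tilde sys ctl"
    have queue: "queue_matrix lam sys ctl = qbd_matrix ((1 - lam) *\<^sub>R N) (lam *\<^sub>R N)
        (A_down lam sys ctl) (A_same lam sys ctl) (A_up lam sys ctl)"
      by (simp add: queue_matrix_def N_def)
    have blocks: "A_down lam sys ctl + A_same lam sys ctl + A_up lam sys ctl = P"
      using P[of lam] by (simp add: phase_process_matrix_def)
    have total: "\<pi> \<bullet> (F_tilde sys ctl *v (\<chi> i. 1)) = 1 - mu_star lam sys ctl"
    proof -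
      have "\<pi> \<bullet> (P *v (\<chi> i. 1)) = 1"
        using \<pi> stationary_distribution_inner_one[OF \<pi>]
        by (simp add: dot_lmul_matrix[symmetric] is_stationary_distribution_def)
      then show ?thesis
        by (simp add: P_def matrix_vector_mult_add_rdistrib inner_add_right mu_star)
    qed
    show ?thesis
    proof (rule qbd_positive_recurrent[OF mc[unfolded queue], where \<pi> = \<pi>], unfold blocks queue[symmetric])
      show "(\<Sum>j\<in>UNIV. ((1 - lam) *\<^sub>R N) $ i $ j + (lam *\<^sub>R N) $ i $ j) = 1" for i
        using queue_matrix_row_sum[OF lam sys ctl, of 0 i]
          sum_qbd_row_boundary[where f = "\<lambda>_. 1" and i = i and ?B0.0 = "(1 - lam) *\<^sub>R N" and ?B1.0 = "lam *\<^sub>R N"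
            and Dn = "A_down lam sys ctl" and Sm = "A_same lam sys ctl" and Up = "A_up lam sys ctl"]
        by (simp add: queue[symmetric])
      have "lam * (1 - mu_star lam sys ctl) < (1 - lam) * mu_star lam sys ctl"
        using stable by (simp add: algebra_simps)
      then show "\<pi> \<bullet> (A_up lam sys ctl *v (\<chi> i. 1)) < \<pi> \<bullet> (A_down lam sys ctl *v (\<chi> i. 1))"
        by (simp add: A_up_def A_down_def scaleR_matrix_vector_assoc[symmetric] total mu_star)
      show "((0, i), z) \<in> {(x, y). 0 < queue_matrix lam sys ctl x y}\<^sup>*" for i z
        by (cases z) (simp add: reachable_from_empty_queue[OF lam sys ctl])
    qed (use stoch pos \<pi> queue_matrix_nonneg[OF lam sys ctl] in auto)
  qed
  moreover have "\<forall>\<rho>. is_stationary_distribution \<rho> P \<longrightarrow> \<rho> = \<pi>"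
    using stationary_distribution_unique[OF stoch pos \<pi>] by blast
  moreover have "\<forall>lam'. 0 < lam' \<and> lam' < 1 \<longrightarrow>
      pi_inf lam' sys ctl = \<pi> \<and> mu_star lam' sys ctl = mu_star lam sys ctl"
    by (simp add: pi_inf mu_star)
  ultimately show ?thesis
    unfolding P pi_inf P_def[symmetric] using stoch ex1 \<pi> by blast
qed

end
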